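(* Let $E,A\in\mathbb{R}^{n\times n}$ be such that the pencil $P(s)=sE-A$ is regular, and let $P'(s)=sA-E$. Then $P$ is non-degenerate dissipative Hamiltonian if and only if all of the following hold: (i) $\operatorname{Re}\lambda\le0$ for each eigenvalue $\lambda\in\mathbb{C}$ of $P$; (ii) non-zero purely imaginary eigenvalues of $P$ are semi-simple; (iii) the index of $P$ is at most two; (iv) the index of $P'$ is at most one.
   Context: A pencil $P(s)=sE-A$ with $E,A\in\mathbb{R}^{n\times n}$ is regular if $P(\mu)$ is invertible for some $\mu\in\mathbb{C}$. It is dissipative Hamiltonian if $A=(J-R)Q$ for some $J,R,Q\in\mathbb{R}^{n\times n}$ with $J=-J^\top$, $R=R^\top\ge0$, $Q^\top E=E^\top Q\ge0$, and non-degenerate dissipative Hamiltonian if such a representation exists with $Q$ invertible. $\lambda\in\mathbb{C}$ is an eigenvalue of $P$ if $P(\lambda)x=0$ for some $x\ne0$; $\lambda=\infty$ is an eigenvalue if $Ex=0$ for some $x\ne0$. A chain of $P$ at the eigenvalue $\lambda$ of length $k+1$ is a tuple $(x_0,\dots,x_k)$ of non-zero vectors in $\mathbb{C}^n$ with, for $\lambda\in\mathbb{C}$: $(A-\lambda E)x_0=0$, $(A-\lambda E)x_j=Ex_{j-1}$ ($j=1,\dots,k$); for $\lambda=\infty$: $Ex_0=0$, $Ex_j=Ax_{j-1}$ ($j=1,\dots,k$). An eigenvalue is semi-simple if there are no chains of length greater than one at it. The index of $P$ is the maximal length of chains at $\lambda=\infty$ ($0$ if $\infty$ is not an eigenvalue);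 the same definitions apply to $P'$ (with the roles of $E$ and $A$ exchanged). *)

theory Defs
  imports
    Complex_Main
    "HOL-Library.Extended_Nat"
    "Jordan_Normal_Form.Matrix"
begin

text \<open>The pencil \<open>s E - A\<close> is represented by the pair \<open>(E, A)\<close> of real \<open>n \<times> n\<close> matrices; the reversed
  pencil \<open>s A - E\<close> is therefore the pair \<open>(A, E)\<close>. Eigenvalues and chains live over the complex
  numbers.\<close>

abbreviation cmat :: "real mat \<Rightarrow> complex mat" where
  "cmat \<equiv> map_mat complex_of_real"

definition pencil :: "real mat \<Rightarrow> real mat \<Rightarrow> complex \<Rightarrow> complex mat" where
  "pencil E A s = s \<cdot>\<^sub>m cmat E - cmat A"

definition regular_pencil :: "real mat \<Rightarrow> real mat \<Rightarrow> bool" where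
  "regular_pencil E A \<longleftrightarrow> (\<exists>\<mu>. invertible_mat (pencil E A \<mu>))"

definition sym_psd :: "nat \<Rightarrow> real mat \<Rightarrow> bool" where
  "sym_psd n M \<longleftrightarrow> M \<in> carrier_mat n n \<and> M\<^sup>T = M \<and>
     (\<forall>x \<in> carrier_vec n. 0 \<le> x \<bullet> (M *\<^sub>v x))"

definition dH_representation ::
  "nat \<Rightarrow> real mat \<Rightarrow> real mat \<Rightarrow> real mat \<Rightarrow> real mat \<Rightarrow> real mat \<Rightarrow> bool" where
  "dH_representation n E A J R Q \<longleftrightarrow>
     J \<in> carrier_mat n n \<and> R \<in> carrier_mat n n \<and> Q \<in> carrier_mat n n \<and>
     A = (J - R) * Q \<and> J = - J\<^sup>T \<and> sym_psd n R \<and>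
     Q\<^sup>T * E = E\<^sup>T * Q \<and> sym_psd n (Q\<^sup>T * E)"

definition nondegenerate_dH :: "nat \<Rightarrow> real mat \<Rightarrow> real mat \<Rightarrow> bool" where
  "nondegenerate_dH n E A \<longleftrightarrow>
     (\<exists>J R Q. dH_representation n E A J R Q \<and> invertible_mat Q)"

definition pencil_eigenvalue :: "nat \<Rightarrow> real mat \<Rightarrow> real mat \<Rightarrow> complex \<Rightarrow> bool" where
  "pencil_eigenvalue n E A z \<longleftrightarrow>
     (\<exists>x \<in> carrier_vec n. x \<noteq> 0\<^sub>v n \<and> pencil E A z *\<^sub>v x = 0\<^sub>v n)"

text \<open>A chain \<open>(x\<^sub>0, \<dots>, x\<^sub>k)\<close> is a list of length \<open>k + 1\<close>.\<close>

definition finite_chain ::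
  "nat \<Rightarrow> real mat \<Rightarrow> real mat \<Rightarrow> complex \<Rightarrow> complex vec list \<Rightarrow> bool" where
  "finite_chain n E A z xs \<longleftrightarrow>
     xs \<noteq> [] \<and> (\<forall>x \<in> set xs. x \<in> carrier_vec n \<and> x \<noteq> 0\<^sub>v n) \<and>
     (cmat A - z \<cdot>\<^sub>m cmat E) *\<^sub>v (xs ! 0) = 0\<^sub>v n \<and>
     (\<forall>j. Suc j < length xs \<longrightarrow>
        (cmat A - z \<cdot>\<^sub>m cmat E) *\<^sub>v (xs ! Suc j) = cmat E *\<^sub>v (xs ! j))"

definition infinite_chain ::
  "nat \<Rightarrow> real mat \<Rightarrow> real mat \<Rightarrow> complex vec list \<Rightarrow> bool" where
  "infinite_chain n E A xs \<longleftrightarrow>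
     xs \<noteq> [] \<and> (\<forall>x \<in> set xs. x \<in> carrier_vec n \<and> x \<noteq> 0\<^sub>v n) \<and>
     cmat E *\<^sub>v (xs ! 0) = 0\<^sub>v n \<and>
     (\<forall>j. Suc j < length xs \<longrightarrow> cmat E *\<^sub>v (xs ! Suc j) = cmat A *\<^sub>v (xs ! j))"

definition semisimple_at :: "nat \<Rightarrow> real mat \<Rightarrow> real mat \<Rightarrow> complex \<Rightarrow> bool" where
  "semisimple_at n E A z \<longleftrightarrow> \<not> (\<exists>xs. finite_chain n E A z xs \<and> length xs > 1)"

text \<open>The supremum is taken in \<open>enat\<close>: it is \<open>0\<close> if there is no chain at infinity, i.e. if infinity
  is not an eigenvalue, it is the maximal chain length if the lengths are bounded, and it is
  \<open>\<infinity>\<close> otherwise (so that an unbounded set of lengths does not produce a junk value).\<close>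

definition pencil_index :: "nat \<Rightarrow> real mat \<Rightarrow> real mat \<Rightarrow> enat" where
  "pencil_index n E A = (SUP xs \<in> {xs. infinite_chain n E A xs}. enat (length xs))"

end

theory Submission
  imports Defs "Jordan_Normal_Form.Jordan_Normal_Form_Existence"
begin

text \<open>With \<open>M = Q\<^sup>T\<close>, a non-degenerate dissipative Hamiltonian representation is the same as an
  invertible real \<open>M\<close> such that \<open>M E\<close> is symmetric positive semidefinite and \<open>x \<bullet> M A x \<le> 0\<close>. Given
  \<open>M\<close>, the conditions follow because a vector on which a semidefinite form vanishes lies in its kernel.

  Conversely, 1 is not an eigenvalue, so \<open>E = G T\<close> and \<open>A = G (T - 1)\<close> with \<open>G = E - A\<close>, and it
  suffices to find a multiplier for \<open>T\<close> and \<open>T - 1\<close>. Index at most two means that \<open>T\<close> has a Drazin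
  inverse \<open>D\<close> with \<open>T\<^sup>2 = T\<^sup>3 D\<close>. On the range of the projection \<open>T D\<close> the generator \<open>1 - D\<close> is Lyapunov
  stable, so it is dissipative for a positive definite form read off its Jordan form. On the complement
  \<open>T\<^sup>2 = 0\<close> and the multiplier is explicit. Taking real parts of quadratic forms, rather than of
  a complex multiplier, keeps everything real and invertible.\<close>

section \<open>Square matrices\<close>

text \<open>With \<open>G = E - A\<close> the equation \<open>A x = z E x\<close> reads
  \<open>(T - 1) x = z T x\<close>, so a finite eigenvalue \<open>z\<close> of the pencil
  corresponds to the nonzero eigenvalue \<open>t = 1 / (1 - z)\<close> of \<open>T\<close>, and
  infinity corresponds to \<open>t = 0\<close>. On the range of \<open>T D\<close>, where
  \<open>D\<close> inverts \<open>T\<close>, this gives \<open>z = 1 - 1 / t\<close>, an eigenvalue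
  of \<open>1 - D\<close>; hence the interest in that matrix. Condition (iv) says that 0 is
  semi-simple, so (ii) and (iv) together cover the whole imaginary axis, while (iii) controls the
  nilpotent part of \<open>T\<close>.

  The two invariant subspaces never receive bases of their own; both are reached through projections
  given by n x n matrices. In particular the Lyapunov form is built for \<open>T D - D\<close>,
  which is \<open>1 - D\<close> on the range of \<open>T D\<close> and 0 on the complement, where it
  adds nothing worse than a semi-simple eigenvalue 0.

  Generalized inverses come from a complex Jordan form. They are asked to satisfy only equations
  that are linear in the unknown with real coefficients, because such equations survive taking the
  real part.\<close>

lemma mult_mat_zero_vec [simp]:
  "A \<in> carrier_mat m n \<Longrightarrow> A *\<^sub>v 0\<^sub>v n = (0\<^sub>v m :: 'a :: semiring_0 vec)"
  by (intro eq_vecI) auto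

lemma inverse_of_det_nonzero:
  fixes A :: "'a :: field mat"
  assumes A: "A \<in> carrier_mat n n" and "det A \<noteq> 0"
  obtains B where "B \<in> carrier_mat n n" "A * B = 1\<^sub>m n" "B * A = 1\<^sub>m n"
  using det_non_zero_imp_unit[OF assms, where b = "()"]
  unfolding Units_def by (auto simp: ring_mat_simps)

lemma inverse_of_trivial_kernel:
  fixes A :: "'a :: field mat"
  assumes A: "A \<in> carrier_mat n n"
    and "\<And>v. v \<in> carrier_vec n \<Longrightarrow> A *\<^sub>v v = 0\<^sub>v n \<Longrightarrow> v = 0\<^sub>v n"
  obtains B where "B \<in> carrier_mat n n" "A * B = 1\<^sub>m n" "B * A = 1\<^sub>m n"
  using inverse_of_det_nonzero[OF A] det_0_iff_vec_prod_zero_field[OF A] assms(2) by blast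

text \<open>The entrywise shadow of a Jordan matrix: a 1 above the diagonal links two equal diagonal
  entries, and this is all that is kept of the block structure. Later estimates can then run over
  plain indices.\<close>

definition bidiagonal :: "nat \<Rightarrow> 'a :: {zero,one} mat \<Rightarrow> bool" where
  "bidiagonal n J \<longleftrightarrow> J \<in> carrier_mat n n \<and>
     (\<forall>i<n. \<forall>j<n. j \<noteq> i \<and> j \<noteq> Suc i \<longrightarrow> J $$ (i, j) = 0) \<and>
     (\<forall>i. Suc i < n \<longrightarrow>
        J $$ (i, Suc i) = 0 \<or> J $$ (i, Suc i) = 1 \<and> J $$ (i, i) = J $$ (Suc i, Suc i))"

lemma bidiagonal_jordan_matrix:
  "bidiagonal (sum_list (map fst n_as)) (jordan_matrix n_as :: 'a :: {zero,one} mat)"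
proof (induction n_as)
  case Nil
  show ?case
    using jordan_matrix_carrier[of "[] :: (nat \<times> 'a) list"] by (auto simp: bidiagonal_def)
next
  case (Cons na n_as)
  obtain m a where na: "na = (m, a)" by force
  let ?N = "sum_list (map fst n_as)"
  let ?J = "jordan_matrix n_as"
  have J: "?J \<in> carrier_mat ?N ?N" by simp
  have dims: "dim_row ?J = ?N" "dim_col ?J = ?N" by simp_all
  have off: "?J $$ (i, j) = 0" if "i < ?N" "j < ?N" "j \<noteq> i" "j \<noteq> Suc i" for i j
    using Cons.IH that by (auto simp: bidiagonal_def)
  have sup: "?J $$ (i, Suc i) = 0 \<or> ?J $$ (i, Suc i) = 1 \<and> ?J $$ (i, i) = ?J $$ (Suc i, Suc i)"
    if "Suc i < ?N" for i
    using Cons.IH that by (auto simp: bidiagonal_def)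
  show ?case
    unfolding bidiagonal_def na jordan_matrix_Cons
  proof (intro conjI allI impI)
    fix i j
    assume "i < sum_list (map fst ((m, a) # n_as))" "j < sum_list (map fst ((m, a) # n_as))"
      "j \<noteq> i \<and> j \<noteq> Suc i"
    then show "four_block_mat (jordan_block m a) (0\<^sub>m m ?N) (0\<^sub>m ?N m) ?J $$ (i, j) = 0"
      by (auto simp: dims jordan_block_def intro!: off)
  next
    fix i
    assume i: "Suc i < sum_list (map fst ((m, a) # n_as))"
    let ?F = "four_block_mat (jordan_block m a) (0\<^sub>m m ?N) (0\<^sub>m ?N m) ?J"
    show "?F $$ (i, Suc i) = 0 \<or> ?F $$ (i, Suc i) = 1 \<and> ?F $$ (i, i) = ?F $$ (Suc i, Suc i)"
    proof (cases "i < m")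
      \<comment> \<open>This includes the junction \<open>i = m - 1\<close>, where the entry at
        \<open>Suc i\<close> already lies in the zero block.\<close>
      case True
      then show ?thesis using i by (auto simp: dims jordan_block_def)
    next
      case False
      then show ?thesis using i sup[of "i - m"] by (simp add: dims Suc_diff_le jordan_block_def)
    qed
  qed (auto simp: dims)
qed

text \<open>Characteristic polynomials split over the complex numbers, so a Jordan form exists. Real
  matrices are complexified before they are brought to this form.\<close>

lemma similar_bidiagonal:
  fixes B :: "complex mat"
  assumes B: "B \<in> carrier_mat n n"
  obtains J S R where "bidiagonal n J" "S \<in> carrier_mat n n" "R \<in> carrier_mat n n"
    "S * R = 1\<^sub>m n" "R * S = 1\<^sub>m n" "B = S * J * R"
proof -
  obtain as where "char_poly B = (\<Prod>a\<leftarrow>as. [:- a, 1:])"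
    using char_poly_factorized[OF B] by auto
  from jordan_nf_exists[OF B this] obtain n_as where "jordan_nf B n_as" ..
  then obtain S R where wit: "similar_mat_wit B (jordan_matrix n_as) S R"
    unfolding jordan_nf_def similar_mat_def by blast
  from similar_mat_witD2[OF B this]
  have J: "jordan_matrix n_as \<in> carrier_mat n n"
    and *: "S \<in> carrier_mat n n" "R \<in> carrier_mat n n"
      "S * R = 1\<^sub>m n" "R * S = 1\<^sub>m n" "B = S * jordan_matrix n_as * R" by auto
  have "sum_list (map fst n_as) = n" using J by (metis carrier_matD(1) jordan_matrix_dim(1))
  with bidiagonal_jordan_matrix[of n_as] have "bidiagonal n (jordan_matrix n_as)" by simp
  with * show thesis using that by blast
qed

text \<open>The number \<open>l\<close> has no generalized eigenvectors of order two; it need not be an eigenvalue.\<close>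

definition nondefective_at :: "nat \<Rightarrow> complex mat \<Rightarrow> complex \<Rightarrow> bool" where
  "nondefective_at n B l \<longleftrightarrow> (\<forall>v \<in> carrier_vec n. \<forall>w \<in> carrier_vec n.
     B *\<^sub>v v = l \<cdot>\<^sub>v v + w \<and> B *\<^sub>v w = l \<cdot>\<^sub>v w \<longrightarrow> w = 0\<^sub>v n)"

lemma nondefective_at_similar:
  assumes nd: "nondefective_at n (S * J * R) l"
    and c: "J \<in> carrier_mat n n" "S \<in> carrier_mat n n" "R \<in> carrier_mat n n"
    and RS: "R * S = 1\<^sub>m n"
  shows "nondefective_at n J l"
  unfolding nondefective_at_def
proof (intro ballI impI; elim conjE)
  fix v w
  assume v: "v \<in> carrier_vec n" and w: "w \<in> carrier_vec n"
    and 1: "J *\<^sub>v v = l \<cdot>\<^sub>v v + w" and 2: "J *\<^sub>v w = l \<cdot>\<^sub>v w"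
  note [simp] = c v w
  have RSx: "R *\<^sub>v (S *\<^sub>v x) = x" if "x \<in> carrier_vec n" for x
    using that assoc_mult_mat_vec[of R n n S n x] RS by simp
  have ev: "(S * J * R) *\<^sub>v (S *\<^sub>v x) = S *\<^sub>v (J *\<^sub>v x)" if "x \<in> carrier_vec n" for x
    using that by (simp add: assoc_mult_mat_vec[of _ n n _ n] mult_carrier_mat[of _ n n _ n]
      mult_mat_vec_carrier[of _ n n] RSx)
  have "(S * J * R) *\<^sub>v (S *\<^sub>v v) = l \<cdot>\<^sub>v (S *\<^sub>v v) + S *\<^sub>v w"
    by (simp add: ev 1 mult_add_distrib_mat_vec[of S n n] mult_mat_vec[of S n n])
  moreover have "(S * J * R) *\<^sub>v (S *\<^sub>v w) = l \<cdot>\<^sub>v (S *\<^sub>v w)"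
    by (simp add: ev 2 mult_mat_vec[of S n n])
  ultimately have "S *\<^sub>v w = 0\<^sub>v n"
    using nd mult_mat_vec_carrier[OF c(2) v] mult_mat_vec_carrier[OF c(2) w]
    unfolding nondefective_at_def by blast
  then show "w = 0\<^sub>v n"
    using RSx[OF w] mult_mat_zero_vec[OF c(3)] by simp
qed

lemma bidiagonal_mult_unit_vec:
  fixes J :: "complex mat"
  assumes J: "bidiagonal n J" and j: "j < n"
  shows "J *\<^sub>v unit_vec n j =
    J $$ (j, j) \<cdot>\<^sub>v unit_vec n j + (if j = 0 then 0\<^sub>v n else J $$ (j - 1, j) \<cdot>\<^sub>v unit_vec n (j - 1))"
proof (rule eq_vecI)
  have c: "J \<in> carrier_mat n n" using J by (simp add: bidiagonal_def)
  fix i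
  assume "i < dim_vec (J $$ (j, j) \<cdot>\<^sub>v unit_vec n j +
    (if j = 0 then 0\<^sub>v n else J $$ (j - 1, j) \<cdot>\<^sub>v unit_vec n (j - 1)))"
  then have i: "i < n" by (simp split: if_splits)
  have "(J *\<^sub>v unit_vec n j) $ i = J $$ (i, j)"
    using i j c by (simp add: row_def)
  moreover have "J $$ (i, j) = 0" if "j \<noteq> i" "j \<noteq> Suc i"
    using J i j that by (auto simp: bidiagonal_def)
  ultimately show "(J *\<^sub>v unit_vec n j) $ i = (J $$ (j, j) \<cdot>\<^sub>v unit_vec n j +
    (if j = 0 then 0\<^sub>v n else J $$ (j - 1, j) \<cdot>\<^sub>v unit_vec n (j - 1))) $ i"
    using i j by (auto simp: unit_vec_def)
qed (use J in \<open>auto simp: bidiagonal_def\<close>)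

text \<open>A 1 at \<open>(k, Suc k)\<close> sends the unit vector at \<open>Suc k\<close> to its
  multiple plus the unit vector at \<open>k\<close>. This contradicts nondefectiveness only if the
  latter is a true eigenvector, that is, if \<open>k\<close> starts its block; taking the least
  offending index for the given eigenvalue ensures this.\<close>

lemma bidiagonal_nondefective:
  assumes J: "bidiagonal n J" and nd: "nondefective_at n J (J $$ (i, i))" and i: "Suc i < n"
  shows "J $$ (i, Suc i) = 0"
proof (rule ccontr)
  let ?l = "J $$ (i, i)"
  let ?bad = "\<lambda>k. Suc k < n \<and> J $$ (k, k) = ?l \<and> J $$ (k, Suc k) \<noteq> 0"
  assume "J $$ (i, Suc i) \<noteq> 0"
  with i have "?bad i" by simp
  define k where "k = (LEAST k. ?bad k)"
  have k: "?bad k" unfolding k_def by (rule LeastI[of ?bad, OF \<open>?bad i\<close>])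
  have least: "\<not> ?bad m" if "m < k" for m
    using not_less_Least[of m ?bad] that unfolding k_def by blast
  have k1: "J $$ (k, Suc k) = 1" "J $$ (Suc k, Suc k) = ?l"
    using J k by (auto simp: bidiagonal_def)
  have "J *\<^sub>v unit_vec n (Suc k) = ?l \<cdot>\<^sub>v unit_vec n (Suc k) + unit_vec n k"
    using bidiagonal_mult_unit_vec[OF J, of "Suc k"] k k1 by simp
  moreover have "J *\<^sub>v unit_vec n k = ?l \<cdot>\<^sub>v unit_vec n k"
  proof (cases k)
    case 0
    then show ?thesis using bidiagonal_mult_unit_vec[OF J, of k] k by simp
  next
    case (Suc m)
    have "J $$ (m, Suc m) = 0 \<or> J $$ (m, Suc m) = 1 \<and> J $$ (m, m) = J $$ (Suc m, Suc m)"
      using J k Suc unfolding bidiagonal_def by (meson Suc_lessD)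
    with k least[of m] Suc have "J $$ (m, Suc m) = 0" by auto
    then show ?thesis using bidiagonal_mult_unit_vec[OF J, of k] k Suc by auto
  qed
  ultimately have "unit_vec n k = (0\<^sub>v n :: complex vec)"
    using nd unit_vec_carrier[of n k] unit_vec_carrier[of n "Suc k"]
    unfolding nondefective_at_def by blast
  then have "(unit_vec n k :: complex vec) $ k = 0\<^sub>v n $ k" by simp
  then show False using k by simp
qed

text \<open>\<open>Z\<close> projects onto the coordinates with diagonal entry 0. Their rows and
  columns in \<open>J\<close> vanish, so \<open>J Z = Z J = 0\<close> and \<open>J + Z\<close> is
  triangular with nonzero diagonal. Its inverse \<open>W\<close> commutes with \<open>J\<close>, and
  \<open>J W J = J - J W Z = J\<close>.\<close>

lemma bidiagonal_group_inverse:
  fixes J :: "complex mat"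
  assumes J: "bidiagonal n J" and nd: "nondefective_at n J 0"
  obtains W where "W \<in> carrier_mat n n" "J * W = W * J" "J * W * J = J"
proof -
  have c [simp]: "J \<in> carrier_mat n n" using J by (simp add: bidiagonal_def)
  define Z :: "complex mat" where
    "Z = mat n n (\<lambda>(i, j). if i = j \<and> J $$ (i, i) = 0 then 1 else 0)"
  have Z [simp]: "Z \<in> carrier_mat n n" by (simp add: Z_def)
  \<comment> \<open>The only critical place is the superdiagonal: a 1 there would force both
    diagonal entries to be 0, against nondefectiveness at 0.\<close>
  have zero: "J $$ (i, j) = 0" if "i < n" "j < n" "J $$ (i, i) = 0 \<or> J $$ (j, j) = 0" for i j
  proof (cases "j = Suc i")
    case True
    then have "J $$ (i, j) = 0 \<or> J $$ (i, i) = J $$ (j, j)"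
      using J that(2) unfolding bidiagonal_def by blast
    then show ?thesis
      using bidiagonal_nondefective[OF J, of i] nd that True by auto
  next
    case False
    then show ?thesis using J that by (cases "i = j") (auto simp: bidiagonal_def)
  qed
  have JZ: "J * Z = 0\<^sub>m n n"
  proof (rule eq_matI)
    fix i j
    assume "i < dim_row (0\<^sub>m n n)" "j < dim_col (0\<^sub>m n n)"
    then have ij: "i < n" "j < n" by auto
    then have "(J * Z) $$ (i, j) = (\<Sum>k<n. J $$ (i, k) * Z $$ (k, j))"
      using carrier_matD[OF c] carrier_matD[OF Z]
      by (simp add: scalar_prod_def lessThan_atLeast0)
    also have "\<dots> = 0"
    proof (intro sum.neutral ballI)
      fix k assume "k \<in> {..<n}"
      then show "J $$ (i, k) * Z $$ (k, j) = 0"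
        using zero[of i k] ij by (auto simp: Z_def)
    qed
    finally show "(J * Z) $$ (i, j) = 0\<^sub>m n n $$ (i, j)" using ij by simp
  qed (use carrier_matD[OF c] carrier_matD[OF Z] in auto)
  have ZJ: "Z * J = 0\<^sub>m n n"
  proof (rule eq_matI)
    fix i j
    assume "i < dim_row (0\<^sub>m n n)" "j < dim_col (0\<^sub>m n n)"
    then have ij: "i < n" "j < n" by auto
    then have "(Z * J) $$ (i, j) = (\<Sum>k<n. Z $$ (i, k) * J $$ (k, j))"
      using carrier_matD[OF c] carrier_matD[OF Z]
      by (simp add: scalar_prod_def lessThan_atLeast0)
    also have "\<dots> = 0"
    proof (intro sum.neutral ballI)
      fix k assume "k \<in> {..<n}"
      then show "Z $$ (i, k) * J $$ (k, j) = 0"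
        using zero[of k j] ij by (auto simp: Z_def)
    qed
    finally show "(Z * J) $$ (i, j) = 0\<^sub>m n n $$ (i, j)" using ij by simp
  qed (use carrier_matD[OF c] carrier_matD[OF Z] in auto)
  have JZc: "J + Z \<in> carrier_mat n n" by simp
  have "upper_triangular (J + Z)"
    using J by (auto simp: upper_triangular_def Z_def bidiagonal_def)
  then have "det (J + Z) = prod_list (diag_mat (J + Z))"
    by (rule det_upper_triangular[OF _ JZc])
  also have "\<dots> \<noteq> 0"
    using carrier_matD[OF c] carrier_matD[OF Z]
    by (auto simp: prod_list_zero_iff diag_mat_def Z_def split: if_splits)
  finally obtain W where W [simp]: "W \<in> carrier_mat n n"
    and W1: "(J + Z) * W = 1\<^sub>m n" and W2: "W * (J + Z) = 1\<^sub>m n"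
    using inverse_of_det_nonzero[OF JZc] by blast
  note sq = assoc_mult_mat[of _ n n _ n _ n] mult_carrier_mat[of _ n n _ n]
    add_mult_distrib_mat[of _ n n _ _ n] mult_add_distrib_mat[of _ n n _ n]
  have comm: "J * (J + Z) = (J + Z) * J"
    by (simp add: sq JZ ZJ)
  have JW: "J * W = W * J"
  proof -
    have "W * J = W * (J * ((J + Z) * W))" by (simp add: W1 right_mult_one_mat[OF c])
    also have "\<dots> = W * ((J * (J + Z)) * W)" using JZc by (simp add: sq del: W1)
    also have "\<dots> = (W * (J + Z)) * (J * W)" unfolding comm using JZc by (simp add: sq)
    finally show ?thesis by (simp add: W2 left_mult_one_mat[of _ n n] mult_carrier_mat[of _ n n _ n])
  qed
  have "J = J * (W * (J + Z))" by (simp add: W2 right_mult_one_mat[OF c])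
  also have "\<dots> = J * W * J + (J * W) * Z" by (simp add: sq)
  also have "(J * W) * Z = 0\<^sub>m n n" by (simp add: JW sq JZ right_mult_zero_mat[of W n n])
  finally have "J * W * J = J" by (metis right_add_zero_mat mult_carrier_mat c W)
  with JW show thesis using that W by blast
qed

lemma group_inverse_complex:
  assumes C: "C \<in> carrier_mat n n" and nd: "nondefective_at n C 0"
  obtains W where "W \<in> carrier_mat n n" "C * W = W * C" "C * W * C = C"
proof -
  obtain J S R where J: "bidiagonal n J" and S [simp]: "S \<in> carrier_mat n n"
    and R [simp]: "R \<in> carrier_mat n n"
    and SR: "S * R = 1\<^sub>m n" and RS: "R * S = 1\<^sub>m n" and CJ: "C = S * J * R"
    using similar_bidiagonal[OF C] by blast
  have Jc [simp]: "J \<in> carrier_mat n n" using J by (simp add: bidiagonal_def)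
  have "nondefective_at n J 0"
    using nondefective_at_similar[OF _ Jc S R RS] nd CJ by blast
  then obtain W where W [simp]: "W \<in> carrier_mat n n" and JW: "J * W = W * J"
    and JWJ: "J * W * J = J"
    using bidiagonal_group_inverse[OF J] by blast
  note sq = assoc_mult_mat[of _ n n _ n _ n] mult_carrier_mat[of _ n n _ n]
  have RSx: "R * (S * X) = X" if "X \<in> carrier_mat n n" for X
    using that assoc_mult_mat[of R n n S n X n] RS by simp
  have 1: "C * (S * W * R) = S * (J * W) * R" by (simp add: CJ sq RSx)
  have 2: "(S * W * R) * C = S * (W * J) * R" by (simp add: CJ sq RSx)
  have 3: "C * (S * W * R) * C = S * (J * W * J) * R" by (simp add: CJ sq RSx)
  show thesis
    by (rule that[of "S * W * R"]) (simp add: sq, simp only: 1 2 JW, metis 3 JWJ CJ)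
qed

subsection \<open>Real matrices as complex matrices\<close>

abbreviation cvec :: "real vec \<Rightarrow> complex vec" where
  "cvec \<equiv> map_vec complex_of_real"

lemma cmat_mult:
  "A \<in> carrier_mat m n \<Longrightarrow> B \<in> carrier_mat n k \<Longrightarrow> cmat (A * B) = cmat A * cmat B"
  by (rule of_real_hom.mat_hom_mult)

lemma cmat_mult_vec:
  "A \<in> carrier_mat m n \<Longrightarrow> v \<in> carrier_vec n \<Longrightarrow> cvec (A *\<^sub>v v) = cmat A *\<^sub>v cvec v"
  by (rule of_real_hom.mult_mat_vec_hom)

lemma Re_cmat_mult_vec:
  assumes "A \<in> carrier_mat m n" "v \<in> carrier_vec n"
  shows "map_vec Re (cmat A *\<^sub>v v) = A *\<^sub>v map_vec Re v"
  using assms by (intro eq_vecI) (auto simp: scalar_prod_def Re_sum intro!: sum.cong)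

lemma Im_cmat_mult_vec:
  assumes "A \<in> carrier_mat m n" "v \<in> carrier_vec n"
  shows "map_vec Im (cmat A *\<^sub>v v) = A *\<^sub>v map_vec Im v"
  using assms by (intro eq_vecI) (auto simp: scalar_prod_def Im_sum intro!: sum.cong)

lemma complex_vec_eqI:
  assumes "map_vec Re v = map_vec Re w" "map_vec Im v = map_vec Im w"
  shows "v = w"
proof (rule eq_vecI)
  show dim: "dim_vec v = dim_vec w" using arg_cong[OF assms(1), of dim_vec] by simp
  fix i assume "i < dim_vec w"
  then show "v $ i = w $ i"
    using dim arg_cong[OF assms(1), of "\<lambda>u. u $ i"] arg_cong[OF assms(2), of "\<lambda>u. u $ i"]
    by (simp add: complex_eq_iff)
qed

text \<open>The kernel condition passes to complex vectors by real and imaginary parts. Both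
  identities for \<open>W\<close> are linear in \<open>W\<close> with real coefficients, so the real
  part of a complex solution solves them. The remaining group inverse identity
  \<open>W C W = W\<close> is quadratic in \<open>W\<close> and would not pass in this way.\<close>

lemma group_inverse_real:
  fixes C :: "real mat"
  assumes C: "C \<in> carrier_mat n n"
    and ker: "\<And>v. v \<in> carrier_vec n \<Longrightarrow> C *\<^sub>v (C *\<^sub>v v) = 0\<^sub>v n \<Longrightarrow> C *\<^sub>v v = 0\<^sub>v n"
  obtains W where "W \<in> carrier_mat n n" "C * W = W * C" "C * W * C = C"
proof -
  have "nondefective_at n (cmat C) 0"
    unfolding nondefective_at_def
  proof (intro ballI impI; elim conjE)
    fix v w
    assume v: "v \<in> carrier_vec n" and w: "w \<in> carrier_vec n"
      and 1: "cmat C *\<^sub>v v = 0 \<cdot>\<^sub>v v + w" and 2: "cmat C *\<^sub>v w = 0 \<cdot>\<^sub>v w"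
    have "0 \<cdot>\<^sub>v v = 0\<^sub>v n" "0 \<cdot>\<^sub>v w = 0\<^sub>v n" using v w by auto
    then have 1: "cmat C *\<^sub>v v = w" and 2: "cmat C *\<^sub>v w = 0\<^sub>v n" using 1 2 w by simp_all
    have z: "map_vec Re (0\<^sub>v n) = 0\<^sub>v n" "map_vec Im (0\<^sub>v n) = 0\<^sub>v n" by auto
    have "C *\<^sub>v map_vec Re v = map_vec Re w" "C *\<^sub>v map_vec Im v = map_vec Im w"
      using Re_cmat_mult_vec[OF C v] Im_cmat_mult_vec[OF C v] 1 by simp_all
    moreover have "C *\<^sub>v map_vec Re w = 0\<^sub>v n" "C *\<^sub>v map_vec Im w = 0\<^sub>v n"
      using Re_cmat_mult_vec[OF C w] Im_cmat_mult_vec[OF C w] 2 z by simp_all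
    ultimately have "map_vec Re w = 0\<^sub>v n" "map_vec Im w = 0\<^sub>v n"
      using ker[of "map_vec Re v"] ker[of "map_vec Im v"] v by simp_all
    then show "w = 0\<^sub>v n" using z by (intro complex_vec_eqI) simp_all
  qed
  then obtain W where W: "W \<in> carrier_mat n n" "cmat C * W = W * cmat C"
      "cmat C * W * cmat C = cmat C"
    using group_inverse_complex[of "cmat C" n] C by auto
  have left: "map_mat Re (cmat C * X) = C * map_mat Re X" if "X \<in> carrier_mat n n" for X
    using that C by (intro eq_matI) (auto simp: scalar_prod_def Re_sum intro!: sum.cong)
  have right: "map_mat Re (X * cmat C) = map_mat Re X * C" if "X \<in> carrier_mat n n" for X
    using that C by (intro eq_matI) (auto simp: scalar_prod_def Re_sum intro!: sum.cong)
  have "C * map_mat Re W * C = map_mat Re (cmat C * W * cmat C)"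
    using right[of "cmat C * W"] left[OF W(1)] W(1) C by (simp del: assoc_mult_mat)
  also have "\<dots> = C" unfolding W(3) by (intro eq_matI) auto
  finally show thesis
    using that[of "map_mat Re W"] W(1) left[OF W(1)] right[OF W(1)] W(2) by simp
qed

section \<open>A Lyapunov form\<close>

text \<open>The growing weights \<open>c ^ k\<close> let the diagonal absorb the superdiagonal; the right-hand side is
  the part of the diagonal term at \<open>m\<close> that the superdiagonal entry at \<open>m - 1\<close> still needs.\<close>

lemma weighted_bidiagonal_sum_le:
  fixes d y :: "nat \<Rightarrow> complex" and e :: "nat \<Rightarrow> real"
  assumes \<delta>: "0 < \<delta>" and c: "c = 1 / \<delta>\<^sup>2"
    and d: "\<And>k. Re (d k) \<le> 0"
    and e: "\<And>k. e k = 0 \<or> e k = 1 \<and> Re (d k) \<le> - \<delta> \<and> Re (d (Suc k)) \<le> - \<delta>"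
  shows "(\<Sum>k<m. c ^ k * Re (cnj (y k) * (d k * y k + of_real (e k) * y (Suc k))))
    \<le> (if m > 0 \<and> e (m - 1) = 1 then \<delta> / 2 * (c ^ m * (cmod (y m))\<^sup>2) else 0)"
proof (induction m)
  case (Suc m)
  define g where "g = (\<lambda>k. c ^ k * (cmod (y k))\<^sup>2)"
  have cpos: "0 < c" using c \<delta> by simp
  have g0: "0 \<le> g k" for k using cpos by (simp add: g_def)
  let ?t = "c ^ m * Re (cnj (y m) * (d m * y m + of_real (e m) * y (Suc m)))"
  have diag: "c ^ m * Re (cnj (y m) * (d m * y m)) = Re (d m) * g m"
  proof -
    have "cnj (y m) * (d m * y m) = d m * of_real ((cmod (y m))\<^sup>2)"
      using complex_norm_square[of "y m"] by (simp add: algebra_simps)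
    then have "Re (cnj (y m) * (d m * y m)) = Re (d m * of_real ((cmod (y m))\<^sup>2))"
      by (rule arg_cong)
    also have "\<dots> = Re (d m) * (cmod (y m))\<^sup>2" by (simp del: of_real_power)
    finally show ?thesis by (simp add: g_def del: times_complex.simps)
  qed
  \<comment> \<open>The constant \<open>c\<close> is tuned to this inequality:
    \<open>(\<delta> * ?a - ?b)^2 \<ge> 0\<close>, divided by \<open>2 * \<delta>\<close>, bounds
    the mixed term by equal multiples \<open>\<delta> / 2\<close> of two consecutive weighted
    squares.\<close>
  have off: "c ^ m * Re (cnj (y m) * y (Suc m)) \<le> \<delta> / 2 * (g m + g (Suc m))"
  proof -
    let ?a = "cmod (y m)" and ?b = "cmod (y (Suc m))"
    have "Re (cnj (y m) * y (Suc m)) \<le> ?a * ?b"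
      using complex_Re_le_cmod[of "cnj (y m) * y (Suc m)"] by (simp add: norm_mult)
    also have "?a * ?b \<le> \<delta> / 2 * (?a\<^sup>2 + c * ?b\<^sup>2)"
    proof -
      have "0 \<le> (\<delta> * ?a - ?b)\<^sup>2 / (2 * \<delta>)" using \<delta> by simp
      also have "\<dots> = \<delta> / 2 * (?a\<^sup>2 + c * ?b\<^sup>2) - ?a * ?b"
        using \<delta> by (simp add: c field_simps power2_eq_square)
      finally show ?thesis by simp
    qed
    finally have "c ^ m * Re (cnj (y m) * y (Suc m)) \<le> c ^ m * (\<delta> / 2 * (?a\<^sup>2 + c * ?b\<^sup>2))"
      using cpos by (simp add: mult_left_mono)
    also have "\<dots> = \<delta> / 2 * (g m + g (Suc m))" by (simp add: g_def algebra_simps)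
    finally show ?thesis .
  qed
  have split: "?t = Re (d m) * g m + e m * (c ^ m * Re (cnj (y m) * y (Suc m)))"
    unfolding diag[symmetric] by (simp add: algebra_simps)
  \<comment> \<open>An inner index of a block is charged \<open>\<delta> / 2 * g m\<close> twice, by
    the links to its predecessor and to its successor. The diagonal contributes at most
    \<open>- \<delta> * g m\<close> and pays for both. \<open>?carry\<close> is the first charge,
    still open when index \<open>m\<close> is reached.\<close>
  let ?carry = "if m > 0 \<and> e (m - 1) = 1 then \<delta> / 2 * g m else 0"
  have carry: "?carry \<le> \<delta> / 2 * g m" "?carry = 0 \<or> Re (d m) \<le> - \<delta>"
    using g0[of m] \<delta> e[of "m - 1"] by auto
  have IH: "(\<Sum>k<m. c ^ k * Re (cnj (y k) * (d k * y k + of_real (e k) * y (Suc k)))) \<le> ?carry"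
    using Suc.IH unfolding g_def .
  have "?carry + ?t \<le> (if e m = 1 then \<delta> / 2 * g (Suc m) else 0)"
  proof (cases "e m = 0")
    case True
    have "Re (d m) * g m \<le> - ?carry"
    proof (cases "?carry = 0")
      case True
      then show ?thesis using d[of m] g0[of m] by (simp add: mult_nonpos_nonneg)
    next
      case False
      then have "Re (d m) * g m \<le> - \<delta> * g m"
        using carry(2) g0 by (intro mult_right_mono) auto
      also have "\<dots> \<le> - (\<delta> / 2 * g m)" using \<delta> g0[of m] by simp
      finally show ?thesis using carry(1) by linarith
    qed
    then show ?thesis using True split by simp
  next
    case False
    then have "e m = 1" and "Re (d m) \<le> - \<delta>" using e[of m] by auto
    then have "Re (d m) * g m \<le> - \<delta> * g m" using g0 by (intro mult_right_mono) auto
    then show ?thesis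
      using off split \<open>e m = 1\<close> carry(1) by (simp add: algebra_simps)
  qed
  moreover have "(if Suc m > 0 \<and> e (Suc m - 1) = 1
      then \<delta> / 2 * (c ^ Suc m * (cmod (y (Suc m)))\<^sup>2) else 0) =
    (if e m = 1 then \<delta> / 2 * g (Suc m) else 0)"
    by (simp add: g_def)
  ultimately show ?case using IH unfolding sum.lessThan_Suc by linarith
qed simp

text \<open>The real part of the Hermitian matrix \<open>Q\<^sup>* diag w Q\<close>.\<close>

definition weighted_gram :: "nat \<Rightarrow> (nat \<Rightarrow> real) \<Rightarrow> complex mat \<Rightarrow> real mat" where
  "weighted_gram n w Q =
     mat n n (\<lambda>(i, j). \<Sum>k<n. w k * Re (cnj (Q $$ (k, i)) * Q $$ (k, j)))"

text \<open>Since \<open>x\<close> and \<open>z\<close> are real, the real part may be taken entry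
  by entry or after evaluating the Hermitian form.\<close>

lemma weighted_gram_form:
  assumes Q: "Q \<in> carrier_mat n n" and x: "x \<in> carrier_vec n" and z: "z \<in> carrier_vec n"
  shows "x \<bullet> (weighted_gram n w Q *\<^sub>v z) =
    (\<Sum>k<n. w k * Re (cnj ((Q *\<^sub>v cvec x) $ k) * (Q *\<^sub>v cvec z) $ k))"
proof -
  have Qx: "(Q *\<^sub>v cvec u) $ k = (\<Sum>i<n. Q $$ (k, i) * of_real (u $ i))"
    if "u \<in> carrier_vec n" "k < n" for u k
    using that Q by (auto simp: scalar_prod_def lessThan_atLeast0)
  have "x \<bullet> (weighted_gram n w Q *\<^sub>v z) =
      (\<Sum>i<n. x $ i * (\<Sum>j<n. (\<Sum>k<n. w k * Re (cnj (Q $$ (k, i)) * Q $$ (k, j))) * z $ j))"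
    using x z by (auto simp: scalar_prod_def weighted_gram_def lessThan_atLeast0 intro!: sum.cong)
  also have "\<dots> = (\<Sum>i<n. \<Sum>j<n. \<Sum>k<n.
      w k * Re (cnj (Q $$ (k, i)) * Q $$ (k, j)) * (x $ i * z $ j))"
    by (simp add: sum_distrib_left sum_distrib_right mult.assoc mult.commute mult.left_commute)
  also have "\<dots> = (\<Sum>i<n. \<Sum>k<n. \<Sum>j<n.
      w k * Re (cnj (Q $$ (k, i)) * Q $$ (k, j)) * (x $ i * z $ j))"
    by (intro sum.cong refl sum.swap)
  also have "\<dots> = (\<Sum>k<n. \<Sum>i<n. \<Sum>j<n.
      w k * Re (cnj (Q $$ (k, i)) * Q $$ (k, j)) * (x $ i * z $ j))"
    by (rule sum.swap)
  also have "\<dots> = (\<Sum>k<n. w k * Re (cnj ((Q *\<^sub>v cvec x) $ k) * (Q *\<^sub>v cvec z) $ k))"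
  proof (intro sum.cong refl)
    fix k assume "k \<in> {..<n}"
    have re: "Re (a * of_real r) = Re a * r" for a r by simp
    from \<open>k \<in> {..<n}\<close> have "cnj ((Q *\<^sub>v cvec x) $ k) * (Q *\<^sub>v cvec z) $ k =
        (\<Sum>i<n. \<Sum>j<n. cnj (Q $$ (k, i)) * Q $$ (k, j) * of_real (x $ i * z $ j))"
      by (simp add: Qx[OF x] Qx[OF z] cnj_sum sum_product) (simp add: mult_ac)
    then have "Re (cnj ((Q *\<^sub>v cvec x) $ k) * (Q *\<^sub>v cvec z) $ k) =
        (\<Sum>i<n. \<Sum>j<n. Re (cnj (Q $$ (k, i)) * Q $$ (k, j)) * (x $ i * z $ j))"
      by (simp only: Re_sum re)
    then show "(\<Sum>i<n. \<Sum>j<n. w k * Re (cnj (Q $$ (k, i)) * Q $$ (k, j)) * (x $ i * z $ j)) =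
        w k * Re (cnj ((Q *\<^sub>v cvec x) $ k) * (Q *\<^sub>v cvec z) $ k)"
      by (simp add: sum_distrib_left mult.assoc)
  qed
  finally show ?thesis .
qed

lemma weighted_gram_transpose: "(weighted_gram n w Q)\<^sup>T = weighted_gram n w Q"
  by (intro eq_matI) (auto simp: weighted_gram_def algebra_simps intro!: sum.cong)

text \<open>In Jordan coordinates \<open>y = R x\<close> the form is a weighted sum of the squared
  moduli of the \<open>y k\<close>, definite because \<open>R\<close> is injective. Nondefectiveness
  on the imaginary axis leaves superdiagonal ones only beside diagonal entries of strictly negative
  real part, as the weighted estimate demands.\<close>

lemma lyapunov:
  fixes B :: "real mat"
  assumes B: "B \<in> carrier_mat n n"
    and spec: "\<And>l v. v \<in> carrier_vec n \<Longrightarrow> v \<noteq> 0\<^sub>v n \<Longrightarrow> cmat B *\<^sub>v v = l \<cdot>\<^sub>v v \<Longrightarrow> Re l \<le> 0"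
    and nd: "\<And>l. Re l = 0 \<Longrightarrow> nondefective_at n (cmat B) l"
  obtains P where "P \<in> carrier_mat n n" "P\<^sup>T = P"
    "\<And>x. x \<in> carrier_vec n \<Longrightarrow> x \<noteq> 0\<^sub>v n \<Longrightarrow> 0 < x \<bullet> (P *\<^sub>v x)"
    "\<And>x. x \<in> carrier_vec n \<Longrightarrow> x \<bullet> (P *\<^sub>v (B *\<^sub>v x)) \<le> 0"
proof -
  obtain J S R where J: "bidiagonal n J" and S [simp]: "S \<in> carrier_mat n n"
    and R [simp]: "R \<in> carrier_mat n n"
    and SR: "S * R = 1\<^sub>m n" and RS: "R * S = 1\<^sub>m n" and BJ: "cmat B = S * J * R"
    using similar_bidiagonal[of "cmat B" n] B by auto
  have Jc [simp]: "J \<in> carrier_mat n n" using J by (simp add: bidiagonal_def)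
  note sq = assoc_mult_mat_vec[of _ n n _ n] mult_carrier_mat[of _ n n _ n]
    mult_mat_vec_carrier[of _ n n]
  have RSx: "R *\<^sub>v (S *\<^sub>v x) = x" if "x \<in> carrier_vec n" for x
    using that assoc_mult_mat_vec[of R n n S n x] RS by simp
  have SRx: "S *\<^sub>v (R *\<^sub>v x) = x" if "x \<in> carrier_vec n" for x
    using that assoc_mult_mat_vec[of S n n R n x] SR by simp
  have BS: "cmat B *\<^sub>v (S *\<^sub>v x) = S *\<^sub>v (J *\<^sub>v x)" if "x \<in> carrier_vec n" for x
    using that by (simp add: BJ sq RSx)
  have ndJ: "nondefective_at n J l" if "Re l = 0" for l
    using nondefective_at_similar[OF _ Jc S R RS] nd[OF that] BJ by simp
  \<comment> \<open>Each diagonal entry is an eigenvalue: the unit vector at the start of a block is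
    an eigenvector, and along a block the entry repeats its predecessor, whence the
    induction.\<close>
  have "Re (J $$ (k, k)) \<le> 0" if k: "k < n" for k
    using that
  proof (induction k)
    case 0
    have "J *\<^sub>v unit_vec n 0 = J $$ (0, 0) \<cdot>\<^sub>v unit_vec n 0"
      using bidiagonal_mult_unit_vec[OF J 0] 0 by simp
    then have "cmat B *\<^sub>v (S *\<^sub>v unit_vec n 0) = J $$ (0, 0) \<cdot>\<^sub>v (S *\<^sub>v unit_vec n 0)"
      by (simp add: BS mult_mat_vec[of S n n])
    moreover have "S *\<^sub>v unit_vec n 0 \<noteq> 0\<^sub>v n"
      using RSx[of "unit_vec n 0"] mult_mat_zero_vec[OF R] 0
      by (metis index_unit_vec(1) index_zero_vec(1) unit_vec_carrier zero_neq_one)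
    ultimately show ?case using spec[of "S *\<^sub>v unit_vec n 0"] by (simp add: sq)
  next
    case (Suc m)
    have "0 \<cdot>\<^sub>v unit_vec n m = (0\<^sub>v n :: complex vec)" by auto
    show ?case
    proof (cases "J $$ (m, Suc m) = 0")
      case True
      with \<open>0 \<cdot>\<^sub>v unit_vec n m = 0\<^sub>v n\<close> have "J *\<^sub>v unit_vec n (Suc m) = J $$ (Suc m, Suc m) \<cdot>\<^sub>v unit_vec n (Suc m)"
        using bidiagonal_mult_unit_vec[OF J Suc.prems] Suc.prems by simp
      then have "cmat B *\<^sub>v (S *\<^sub>v unit_vec n (Suc m)) =
          J $$ (Suc m, Suc m) \<cdot>\<^sub>v (S *\<^sub>v unit_vec n (Suc m))"
        by (simp add: BS mult_mat_vec[of S n n])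
      moreover have "S *\<^sub>v unit_vec n (Suc m) \<noteq> 0\<^sub>v n"
        using RSx[of "unit_vec n (Suc m)"] mult_mat_zero_vec[OF R] Suc.prems
        by (metis index_unit_vec(1) index_zero_vec(1) unit_vec_carrier zero_neq_one)
      ultimately show ?thesis using spec[of "S *\<^sub>v unit_vec n (Suc m)"] by (simp add: sq)
    next
      case False
      then have "J $$ (m, m) = J $$ (Suc m, Suc m)"
        using J Suc.prems unfolding bidiagonal_def by blast
      then show ?thesis using Suc by simp
    qed
  qed
  note dJ = this
  \<comment> \<open>\<open>\<delta>\<close> is the distance of the strictly stable diagonal entries
    from the imaginary axis, capped at 1 so that the minimum exists even when there are
    none.\<close>
  define T where "T = {- Re (J $$ (k, k)) |k. k < n \<and> Re (J $$ (k, k)) < 0}"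
  define \<delta> where "\<delta> = Min (insert 1 T)"
  have finT: "finite T" by (simp add: T_def)
  have \<delta>: "0 < \<delta>" unfolding \<delta>_def using finT by (subst Min_gr_iff) (auto simp: T_def)
  have \<delta>le: "Re (J $$ (k, k)) \<le> - \<delta>" if "k < n" "Re (J $$ (k, k)) < 0" for k
  proof -
    have "\<delta> \<le> - Re (J $$ (k, k))"
      unfolding \<delta>_def using finT that by (intro Min_le) (auto simp: T_def)
    then show ?thesis by simp
  qed
  \<comment> \<open>The extension beyond \<open>n\<close> keeps the sign condition for every index.
    \<open>e\<close> vanishes from the last index \<open>n - 1\<close> on, which silences the
    out-of-range entry \<open>y $ n\<close> and makes the final carry 0.\<close>
  define d where "d k = (if k < n then J $$ (k, k) else -1)" for k
  define e where "e k = (if Suc k < n then Re (J $$ (k, Suc k)) else 0)" for k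
  define w where "w k = (1 / \<delta>\<^sup>2) ^ k" for k
  define P where "P = weighted_gram n w R"
  have d0: "Re (d k) \<le> 0" for k using dJ by (simp add: d_def)
  have e01: "e k = 0 \<or> e k = 1 \<and> Re (d k) \<le> - \<delta> \<and> Re (d (Suc k)) \<le> - \<delta>" for k
  proof (cases "Suc k < n \<and> J $$ (k, Suc k) \<noteq> 0")
    case True
    then have "J $$ (k, Suc k) = 1" "J $$ (k, k) = J $$ (Suc k, Suc k)"
      using J unfolding bidiagonal_def by blast+
    moreover have "Re (J $$ (k, k)) \<noteq> 0"
      using True bidiagonal_nondefective[OF J, of k] ndJ by blast
    ultimately show ?thesis
      using True dJ[of k] \<delta>le[of k] by (auto simp: d_def e_def)
  qed (auto simp: e_def)
  have Jy: "(J *\<^sub>v y) $ k = d k * y $ k + of_real (e k) * y $ Suc k"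
    if k: "k < n" and y: "y \<in> carrier_vec n" for y k
  proof -
    have off: "J $$ (k, j) = 0" if "j < n" "j \<noteq> k" "j \<noteq> Suc k" for j
      using J k that by (auto simp: bidiagonal_def)
    have "(J *\<^sub>v y) $ k = (\<Sum>j<n. J $$ (k, j) * y $ j)"
      using k y carrier_matD[OF Jc] by (auto simp: scalar_prod_def lessThan_atLeast0)
    also have "\<dots> = (\<Sum>j\<in>(if Suc k < n then {k, Suc k} else {k}). J $$ (k, j) * y $ j)"
      using k off by (intro sum.mono_neutral_right) auto
    also have "\<dots> = d k * y $ k + of_real (e k) * y $ Suc k"
    proof (cases "Suc k < n")
      case True
      then have "J $$ (k, Suc k) = 0 \<or> J $$ (k, Suc k) = 1"
        using J unfolding bidiagonal_def by blast
      then show ?thesis using k True by (auto simp: d_def e_def)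
    qed (use k in \<open>simp add: d_def e_def\<close>)
    finally show ?thesis .
  qed
  have pos: "0 < x \<bullet> (P *\<^sub>v x)" if x: "x \<in> carrier_vec n" "x \<noteq> 0\<^sub>v n" for x
  proof -
    let ?y = "R *\<^sub>v cvec x"
    have y: "?y \<in> carrier_vec n" using x by (simp add: sq)
    have "?y \<noteq> 0\<^sub>v n"
    proof
      assume "?y = 0\<^sub>v n"
      then have "cvec x = 0\<^sub>v n" using SRx[of "cvec x"] x mult_mat_zero_vec[OF S] by simp
      then show False using x by simp
    qed
    then obtain k where k: "k < n" "?y $ k \<noteq> 0"
      using y by (metis carrier_vecD eq_vecI index_zero_vec)
    have form: "x \<bullet> (P *\<^sub>v x) = (\<Sum>k<n. w k * (cmod (?y $ k))\<^sup>2)"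
      unfolding P_def weighted_gram_form[OF R x(1) x(1)]
      by (intro sum.cong refl) (simp add: cmod_power2, simp add: power2_eq_square)
    show ?thesis unfolding form
      using k \<delta> by (intro sum_pos2[of _ k]) (auto simp: w_def)
  qed
  have neg: "x \<bullet> (P *\<^sub>v (B *\<^sub>v x)) \<le> 0" if x: "x \<in> carrier_vec n" for x
  proof -
    let ?y = "R *\<^sub>v cvec x"
    have y: "?y \<in> carrier_vec n" using x by (simp add: sq)
    have RB: "R *\<^sub>v cvec (B *\<^sub>v x) = J *\<^sub>v ?y"
      using x B by (simp add: cmat_mult_vec[of B n n] BJ sq RSx)
    have Bx: "B *\<^sub>v x \<in> carrier_vec n" using B x by (simp add: sq)
    have "x \<bullet> (P *\<^sub>v (B *\<^sub>v x)) = (\<Sum>k<n. w k * Re (cnj (?y $ k) * (J *\<^sub>v ?y) $ k))"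
      unfolding P_def weighted_gram_form[OF R x Bx] RB ..
    also have "\<dots> = (\<Sum>k<n. w k *
        Re (cnj (?y $ k) * (d k * ?y $ k + of_real (e k) * ?y $ Suc k)))"
      using Jy[OF _ y] by (intro sum.cong refl) simp
    also have "\<dots> \<le> (if n > 0 \<and> e (n - 1) = 1
        then \<delta> / 2 * ((1 / \<delta>\<^sup>2) ^ n * (cmod (?y $ n))\<^sup>2) else 0)"
      unfolding w_def
      by (rule weighted_bidiagonal_sum_le[where y = "\<lambda>k. ?y $ k" and d = d and e = e, OF \<delta> refl d0 e01])
    also have "\<dots> = 0" by (simp add: e_def)
    finally show ?thesis .
  qed
  show thesis
    by (rule that[of P]) (use pos neg weighted_gram_transpose in \<open>auto simp: P_def weighted_gram_def\<close>)
qed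

section \<open>A multiplier for a matrix of index two\<close>

lemma zero_mat_mult_vec:
  "v \<in> carrier_vec n \<Longrightarrow> 0\<^sub>m m n *\<^sub>v v = (0\<^sub>v m :: 'a :: semiring_0 vec)"
  by (intro eq_vecI) auto

lemma scalar_prod_self_nonneg: "0 \<le> (v :: real vec) \<bullet> v"
  using conjugate_square_ge_0_vec[of v] by simp

lemma scalar_prod_self_eq_0: "(v :: real vec) \<in> carrier_vec n \<Longrightarrow> v \<bullet> v = 0 \<longleftrightarrow> v = 0\<^sub>v n"
  using conjugate_square_eq_0_vec[of v n] by simp

lemma transpose_scalar_prod:
  fixes A :: "real mat"
  assumes "A \<in> carrier_mat m n" "x \<in> carrier_vec n" "y \<in> carrier_vec m"
  shows "x \<bullet> (A\<^sup>T *\<^sub>v y) = (A *\<^sub>v x) \<bullet> y"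
  using transpose_vec_mult_scalar[OF assms] comm_scalar_prod[of x n "A\<^sup>T *\<^sub>v y"]
    comm_scalar_prod[of y m "A *\<^sub>v x"] assms by simp

lemma eq_0_of_scalar_prods:
  fixes v :: "real vec"
  assumes "v \<in> carrier_vec n" "\<And>z. z \<in> carrier_vec n \<Longrightarrow> z \<bullet> v = 0"
  shows "v = 0\<^sub>v n"
  using scalar_prod_self_eq_0[OF assms(1)] assms by blast

lemma eq_mat_of_scalar_prods:
  fixes A B :: "real mat"
  assumes A: "A \<in> carrier_mat n n" and B: "B \<in> carrier_mat n n"
    and eq: "\<And>x z. x \<in> carrier_vec n \<Longrightarrow> z \<in> carrier_vec n \<Longrightarrow> x \<bullet> (A *\<^sub>v z) = x \<bullet> (B *\<^sub>v z)"
  shows "A = B"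
proof (rule eq_matI)
  have entry: "unit_vec n i \<bullet> (C *\<^sub>v unit_vec n j) = C $$ (i, j)"
    if "C \<in> carrier_mat n n" "i < n" "j < n" for C :: "real mat" and i j
    using that by simp
  fix i j assume "i < dim_row B" "j < dim_col B"
  then show "A $$ (i, j) = B $$ (i, j)"
    using eq[of "unit_vec n i" "unit_vec n j"] entry[OF A, of i j] entry[OF B, of i j] B by simp
qed (use A B in auto)

text \<open>By the kernel condition \<open>C = T T\<close> satisfies ker \<open>C C\<close> = ker
  \<open>C\<close> and so has a commuting generalized inverse \<open>W\<close>. Then
  \<open>C W\<close> is the spectral projection off the nilpotent part of \<open>T\<close>, and
  \<open>D\<close> is to invert \<open>T\<close> there.\<close>

lemma drazin_inverse_index_two:
  fixes T :: "real mat"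
  assumes T [simp]: "T \<in> carrier_mat n n"
    and ker: "\<And>v. v \<in> carrier_vec n \<Longrightarrow> T *\<^sub>v (T *\<^sub>v (T *\<^sub>v v)) = 0\<^sub>v n \<Longrightarrow> T *\<^sub>v (T *\<^sub>v v) = 0\<^sub>v n"
  obtains D where "D \<in> carrier_mat n n" "D * T = T * D" "D * (T * D) = D"
    "T * (T * (T * D)) = T * T"
proof -
  note sq = assoc_mult_mat[of _ n n _ n _ n] mult_carrier_mat[of _ n n _ n]
  note sqv = assoc_mult_mat_vec[of _ n n _ n] mult_mat_vec_carrier[of _ n n]
  define C where "C = T * T"
  have C [simp]: "C \<in> carrier_mat n n" by (simp add: C_def sq)
  have "C *\<^sub>v v = 0\<^sub>v n" if v: "v \<in> carrier_vec n" "C *\<^sub>v (C *\<^sub>v v) = 0\<^sub>v n" for v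
  proof -
    have "T *\<^sub>v (T *\<^sub>v (T *\<^sub>v (T *\<^sub>v v))) = 0\<^sub>v n"
      using v by (simp add: C_def sqv)
    then have "T *\<^sub>v (T *\<^sub>v (T *\<^sub>v v)) = 0\<^sub>v n"
      using ker[of "T *\<^sub>v v"] v by (simp add: sqv)
    then show ?thesis using ker[of v] v by (simp add: C_def sqv)
  qed
  then obtain W where W [simp]: "W \<in> carrier_mat n n" and CW: "C * W = W * C"
    and CWC: "C * W * C = C"
    using group_inverse_real[OF C] by blast
  have 1: "W * (C * X) = C * (W * X)" if "X \<in> carrier_mat n n" for X
    using that CW assoc_mult_mat[of W n n C n X n] assoc_mult_mat[of C n n W n X n] by simp
  have CCW: "C * (C * W) = C"
    using CWC assoc_mult_mat[OF C W C] CW by simp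
  have 2: "C * (C * (W * X)) = C * X" if "X \<in> carrier_mat n n" for X
    using that arg_cong[OF CCW, of "\<lambda>Y. Y * X"] by (simp add: sq)
  have TC: "T * C = C * T" by (simp add: C_def sq)
  have 3: "T * (C * X) = C * (T * X)" if "X \<in> carrier_mat n n" for X
    using that TC assoc_mult_mat[of T n n C n X n] assoc_mult_mat[of C n n T n X n] by simp
  note norm = CW[symmetric] 1 CCW 2 TC 3
  \<comment> \<open>\<open>W\<close> is only known to commute with \<open>C\<close>, not with
    \<open>T\<close>. Multiplied by \<open>C\<close> it does commute: insert
    \<open>C = C C W\<close> and move the factors \<open>C\<close> past \<open>T\<close> and past
    \<open>W\<close>.\<close>
  have CWT: "C * (W * T) = C * (T * W)"
  proof -
    have "C * (W * T) = W * (T * C)" by (simp add: norm sq)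
    also have "\<dots> = W * (T * (C * (C * W)))" by (simp only: CCW)
    also have "\<dots> = C * (T * W)" by (simp add: 1 2 3 sq)
    finally show ?thesis .
  qed
  have 4: "C * (W * (T * X)) = C * (T * (W * X))" if "X \<in> carrier_mat n n" for X
    using that arg_cong[OF CWT, of "\<lambda>Y. Y * X"] by (simp add: sq)
  have TT: "T * (T * X) = C * X" if "X \<in> carrier_mat n n" for X
    using that by (simp add: C_def sq)
  \<comment> \<open>\<open>C W W\<close> is the genuine group inverse of \<open>T T\<close>, the
    factor \<open>C W\<close> removing whatever \<open>W\<close> does on the kernel of
    \<open>C\<close>. One further factor \<open>T\<close> turns an inverse of the square into an
    inverse of \<open>T\<close>.\<close>
  define D where "D = T * (C * (W * W))"
  have [simp]: "D \<in> carrier_mat n n" by (simp add: D_def sq)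
  have TD: "T * D = C * W" by (simp add: D_def sq TT norm)
  have "D * T = C * (T * (W * (W * T)))" by (simp add: D_def sq norm)
  also have "\<dots> = C * (W * (T * (W * T)))" by (simp add: 4 sq)
  also have "\<dots> = W * (T * (C * (W * T)))" by (simp add: norm sq)
  also have "\<dots> = W * (T * (C * (T * W)))" by (simp add: CWT)
  also have "\<dots> = W * (C * (C * W))" by (simp add: norm sq TT)
  also have "\<dots> = C * W" by (simp add: norm sq)
  finally have DT: "D * T = T * D" by (simp add: TD)
  have "D * (T * D) = T * (C * (W * (W * (C * W))))" unfolding TD by (simp add: D_def sq)
  also have "\<dots> = D" by (simp add: D_def norm sq)
  finally have DTD: "D * (T * D) = D" .
  have "T * (T * (T * D)) = T * T" by (simp add: TD TT sq norm CCW) (simp add: C_def)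
  with DT DTD show thesis using that[of D] by simp
qed

text \<open>\<open>K\<close> is the orthogonal projection onto the kernel of the transpose of
  \<open>X\<close>. The symmetric matrix \<open>S\<close> has the same kernel as its square, so it
  has a commuting generalized inverse \<open>W\<close>, and \<open>S W\<close> projects onto the
  range of \<open>S\<close>.\<close>

lemma cokernel_projection:
  fixes X :: "real mat"
  assumes X [simp]: "X \<in> carrier_mat n n"
  obtains K where "K \<in> carrier_mat n n" "K * X = 0\<^sub>m n n"
    "\<And>y. y \<in> carrier_vec n \<Longrightarrow> X\<^sup>T *\<^sub>v y = 0\<^sub>v n \<Longrightarrow> K *\<^sub>v y = y"
proof -
  note sq = assoc_mult_mat[of _ n n _ n _ n] mult_carrier_mat[of _ n n _ n]
  note sqv = assoc_mult_mat_vec[of _ n n _ n] mult_mat_vec_carrier[of _ n n]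
  define S where "S = X * X\<^sup>T"
  have S [simp]: "S \<in> carrier_mat n n" by (simp add: S_def sq)
  have ST: "S\<^sup>T = S" by (simp add: S_def transpose_mult[of _ n n _ n])
  have kerS: "X\<^sup>T *\<^sub>v v = 0\<^sub>v n" if v: "v \<in> carrier_vec n" "S *\<^sub>v v = 0\<^sub>v n" for v
  proof -
    have "(X\<^sup>T *\<^sub>v v) \<bullet> (X\<^sup>T *\<^sub>v v) = v \<bullet> (S *\<^sub>v v)"
      using transpose_scalar_prod[of "X\<^sup>T" n n v "X\<^sup>T *\<^sub>v v"] v(1) by (simp add: S_def sqv)
    then show ?thesis
      using v scalar_prod_self_eq_0[of "X\<^sup>T *\<^sub>v v" n] by (simp add: sqv)
  qed
  have "S *\<^sub>v v = 0\<^sub>v n" if v: "v \<in> carrier_vec n" "S *\<^sub>v (S *\<^sub>v v) = 0\<^sub>v n" for v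
  proof -
    have "(S *\<^sub>v v) \<bullet> (S *\<^sub>v v) = v \<bullet> (S *\<^sub>v (S *\<^sub>v v))"
      using transpose_scalar_prod[of S n n v "S *\<^sub>v v"] v(1) by (simp add: ST sqv)
    then show ?thesis
      using v scalar_prod_self_eq_0[of "S *\<^sub>v v" n] by (simp add: sqv)
  qed
  then obtain W where W [simp]: "W \<in> carrier_mat n n" and SW: "S * W = W * S"
    and SWS: "S * W * S = S"
    using group_inverse_real[OF S] by blast
  define K where "K = 1\<^sub>m n - S * W"
  have K [simp]: "K \<in> carrier_mat n n" by (simp add: K_def sq minus_carrier_mat)
  have "K * S = S - S * W * S"
    by (simp add: K_def minus_mult_distrib_mat[of _ n n _ _ n] sq left_mult_one_mat[OF S])
  then have KS: "K * S = 0\<^sub>m n n" unfolding SWS by simp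
  \<comment> \<open>Transposing \<open>K S = 0\<close> shows that \<open>S\<close> kills the range
    of the transpose of \<open>K\<close>; by \<open>kerS\<close> so does the transpose of
    \<open>X\<close>. Transposing once more gives \<open>K X = 0\<close>.\<close>
  have XK: "X\<^sup>T *\<^sub>v (K\<^sup>T *\<^sub>v z) = 0\<^sub>v n" if z: "z \<in> carrier_vec n" for z
  proof (rule kerS)
    have "S * K\<^sup>T = (K * S)\<^sup>T" by (simp add: transpose_mult[of _ n n _ n] ST)
    then have "S * K\<^sup>T = 0\<^sub>m n n" using KS by simp
    then show "S *\<^sub>v (K\<^sup>T *\<^sub>v z) = 0\<^sub>v n"
      using z assoc_mult_mat_vec[of S n n "K\<^sup>T" n z] by (simp add: zero_mat_mult_vec)
  qed (use z in \<open>simp add: sqv\<close>)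
  have "K * X = 0\<^sub>m n n"
  proof (rule eq_mat_of_scalar_prods)
    fix x z :: "real vec" assume x: "x \<in> carrier_vec n" and z: "z \<in> carrier_vec n"
    have "x \<bullet> ((K * X) *\<^sub>v z) = (X\<^sup>T *\<^sub>v (K\<^sup>T *\<^sub>v x)) \<bullet> z"
      using x z transpose_scalar_prod[of "K\<^sup>T" n n x "X *\<^sub>v z"]
        transpose_scalar_prod[of "X\<^sup>T" n n "K\<^sup>T *\<^sub>v x" z] by (simp add: sqv)
    then show "x \<bullet> ((K * X) *\<^sub>v z) = x \<bullet> (0\<^sub>m n n *\<^sub>v z)"
      using x z by (simp add: XK zero_mat_mult_vec)
  qed (simp_all add: sq)
  moreover have "K *\<^sub>v y = y" if y: "y \<in> carrier_vec n" "X\<^sup>T *\<^sub>v y = 0\<^sub>v n" for y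
  proof -
    have "K *\<^sub>v y = y - W *\<^sub>v (X *\<^sub>v (X\<^sup>T *\<^sub>v y))"
      using y(1) unfolding K_def SW
      by (simp add: minus_mult_distrib_mat_vec[of _ n n] sq sqv S_def)
    also have "\<dots> = y" using y by (simp add: mult_mat_zero_vec[of _ n n])
    finally show ?thesis .
  qed
  ultimately show thesis using that K by blast
qed

text \<open>\<open>T * D\<close> is a spectral projection of \<open>T\<close>. On its range \<open>T\<close> is invertible and the Lyapunov form
  \<open>P\<close> is used; on its kernel \<open>T\<^sup>2 = 0\<close>, and there the multiplier is built from \<open>T\<close> and its transpose.\<close>

lemma dissipative_multiplier:
  fixes T D P :: "real mat"
  assumes T [simp]: "T \<in> carrier_mat n n" and D [simp]: "D \<in> carrier_mat n n"
    and P [simp]: "P \<in> carrier_mat n n"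
    and DT: "D * T = T * D" and DTD: "D * (T * D) = D" and TTTD: "T * (T * (T * D)) = T * T"
    and PT: "P\<^sup>T = P"
    and pos: "\<And>x. x \<in> carrier_vec n \<Longrightarrow> x \<noteq> 0\<^sub>v n \<Longrightarrow> 0 < x \<bullet> (P *\<^sub>v x)"
    and neg: "\<And>x. x \<in> carrier_vec n \<Longrightarrow> x \<bullet> (P *\<^sub>v ((T * D - D) *\<^sub>v x)) \<le> 0"
  obtains M where "M \<in> carrier_mat n n" "(M * T)\<^sup>T = M * T"
    "\<And>x. x \<in> carrier_vec n \<Longrightarrow> 0 \<le> x \<bullet> ((M * T) *\<^sub>v x)"
    "\<And>x. x \<in> carrier_vec n \<Longrightarrow> x \<bullet> (M *\<^sub>v (T *\<^sub>v x - x)) \<le> 0"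
    "\<And>x. x \<in> carrier_vec n \<Longrightarrow> M *\<^sub>v x = 0\<^sub>v n \<Longrightarrow> x = 0\<^sub>v n"
proof -
  note sq = mult_carrier_mat[of _ n n _ n] mult_mat_vec_carrier[of _ n n]
    minus_carrier_vec[of _ n] minus_carrier_mat
  note asc = assoc_mult_mat_vec[of _ n n _ n]
  \<comment> \<open>\<open>F\<close> and \<open>U\<close> are the complementary spectral
    projections, and \<open>X\<close> is the nilpotent part of \<open>T\<close>, with
    \<open>X T = 0\<close>.\<close>
  define F where "F = T * D"
  define U where "U = 1\<^sub>m n - F"
  define X where "X = T * U"
  have F [simp]: "F \<in> carrier_mat n n" by (simp add: F_def sq)
  have U [simp]: "U \<in> carrier_mat n n" by (simp add: U_def sq)
  have X [simp]: "X \<in> carrier_mat n n" by (simp add: X_def sq)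
  have Fv: "F *\<^sub>v x = T *\<^sub>v (D *\<^sub>v x)" if "x \<in> carrier_vec n" for x
    using that by (simp add: F_def asc)
  have Uv: "U *\<^sub>v x = x - T *\<^sub>v (D *\<^sub>v x)" if "x \<in> carrier_vec n" for x
    using that by (simp add: U_def minus_mult_distrib_mat_vec[of _ n n] Fv)
  have DTv: "D *\<^sub>v (T *\<^sub>v x) = T *\<^sub>v (D *\<^sub>v x)" if "x \<in> carrier_vec n" for x
    using that arg_cong[OF DT, of "\<lambda>A. A *\<^sub>v x"] by (simp add: asc)
  have DTDv: "T *\<^sub>v (D *\<^sub>v (D *\<^sub>v x)) = D *\<^sub>v x" if "x \<in> carrier_vec n" for x
    using that arg_cong[OF DTD, of "\<lambda>A. A *\<^sub>v x"] by (simp add: asc sq DTv)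
  have TTTDv: "T *\<^sub>v (T *\<^sub>v (T *\<^sub>v (D *\<^sub>v x))) = T *\<^sub>v (T *\<^sub>v x)" if "x \<in> carrier_vec n" for x
    using that arg_cong[OF TTTD, of "\<lambda>A. A *\<^sub>v x"] by (simp add: asc sq)
  have Xv: "X *\<^sub>v x = T *\<^sub>v x - T *\<^sub>v (T *\<^sub>v (D *\<^sub>v x))" if "x \<in> carrier_vec n" for x
    using that by (simp add: X_def asc Uv mult_minus_distrib_mat_vec[of _ n n] sq)
  have FT: "F *\<^sub>v (T *\<^sub>v x) = T *\<^sub>v (T *\<^sub>v (D *\<^sub>v x))" if "x \<in> carrier_vec n" for x
    using that by (simp add: Fv DTv sq)
  have UT: "U *\<^sub>v (T *\<^sub>v x) = X *\<^sub>v x" if "x \<in> carrier_vec n" for x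
    using that by (simp add: Uv Xv DTv sq)
  have XT: "X *\<^sub>v (T *\<^sub>v x) = 0\<^sub>v n" if "x \<in> carrier_vec n" for x
    using that by (simp add: Xv DTv sq TTTDv)
  obtain K where K [simp]: "K \<in> carrier_mat n n" and KX: "K * X = 0\<^sub>m n n"
    and Kfix: "\<And>y. y \<in> carrier_vec n \<Longrightarrow> X\<^sup>T *\<^sub>v y = 0\<^sub>v n \<Longrightarrow> K *\<^sub>v y = y"
    using cokernel_projection[OF X] by blast
  have KXv: "K *\<^sub>v (X *\<^sub>v x) = 0\<^sub>v n" if "x \<in> carrier_vec n" for x
    using that arg_cong[OF KX, of "\<lambda>A. A *\<^sub>v x"] by (simp add: asc zero_mat_mult_vec)
  define V where "V = K * U"
  have V [simp]: "V \<in> carrier_mat n n" by (simp add: V_def sq)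
  have VT: "V *\<^sub>v (T *\<^sub>v x) = 0\<^sub>v n" if "x \<in> carrier_vec n" for x
    using that by (simp add: V_def asc sq UT KXv)
  \<comment> \<open>The first term carries the Lyapunov form. The skew pair in \<open>X\<close> and
    \<open>U\<close> is invisible in \<open>x \<bullet> M x\<close>, yet after multiplication by
    \<open>T\<close> it leaves the square of \<open>X\<close>. The separate square of
    \<open>X\<close> cancels that contribution in the form of \<open>M (T - 1)\<close>. The square
    of \<open>V\<close> vanishes on the range of \<open>T\<close> and makes \<open>M\<close>
    injective on what the other terms miss.\<close>
  define M where "M = F\<^sup>T * (P * D) + X\<^sup>T * U - U\<^sup>T * X + X\<^sup>T * X + V\<^sup>T * V"
  have M [simp]: "M \<in> carrier_mat n n" by (simp add: M_def sq)
  have form: "x \<bullet> (M *\<^sub>v z) = (F *\<^sub>v x) \<bullet> (P *\<^sub>v (D *\<^sub>v z)) + (X *\<^sub>v x) \<bullet> (U *\<^sub>v z)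
      - (U *\<^sub>v x) \<bullet> (X *\<^sub>v z) + (X *\<^sub>v x) \<bullet> (X *\<^sub>v z) + (V *\<^sub>v x) \<bullet> (V *\<^sub>v z)"
    if x: "x \<in> carrier_vec n" and z: "z \<in> carrier_vec n" for x z
    using that transpose_scalar_prod[of _ n n x]
    by (simp add: M_def sq asc add_mult_distrib_mat_vec[of _ n n] minus_mult_distrib_mat_vec[of _ n n]
      scalar_prod_add_distrib[of _ n] scalar_prod_minus_distrib[of _ n])
  have P_sym: "x \<bullet> (P *\<^sub>v z) = z \<bullet> (P *\<^sub>v x)" if "x \<in> carrier_vec n" "z \<in> carrier_vec n" for x z
    using that transpose_scalar_prod[of P n n x z] PT comm_scalar_prod[of "P *\<^sub>v x" n z]
    by (simp add: sq)
  have P_nonneg: "0 \<le> x \<bullet> (P *\<^sub>v x)" if "x \<in> carrier_vec n" for x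
    using pos[OF that] that by (cases "x = 0\<^sub>v n") (auto simp: sq)
  have MT: "x \<bullet> (M *\<^sub>v (T *\<^sub>v z)) = (F *\<^sub>v x) \<bullet> (P *\<^sub>v (F *\<^sub>v z)) + (X *\<^sub>v x) \<bullet> (X *\<^sub>v z)"
    if "x \<in> carrier_vec n" "z \<in> carrier_vec n" for x z
    using that by (simp add: form sq DTv Fv UT XT VT scalar_prod_right_zero[of _ n])
  have sym: "(M * T)\<^sup>T = M * T"
  proof (rule eq_mat_of_scalar_prods)
    fix x z :: "real vec" assume x: "x \<in> carrier_vec n" and z: "z \<in> carrier_vec n"
    have "x \<bullet> ((M * T)\<^sup>T *\<^sub>v z) = z \<bullet> (M *\<^sub>v (T *\<^sub>v x))"
      using x z transpose_scalar_prod[of "M * T" n n x z]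
        comm_scalar_prod[of z n "M *\<^sub>v (T *\<^sub>v x)"] by (simp add: sq asc)
    also have "\<dots> = x \<bullet> ((M * T) *\<^sub>v z)"
      using x z P_sym[of "F *\<^sub>v x" "F *\<^sub>v z"] comm_scalar_prod[of "X *\<^sub>v x" n "X *\<^sub>v z"]
      by (simp add: MT sq asc)
    finally show "x \<bullet> ((M * T)\<^sup>T *\<^sub>v z) = x \<bullet> ((M * T) *\<^sub>v z)" .
  qed (simp_all add: sq)
  have psd: "0 \<le> x \<bullet> ((M * T) *\<^sub>v x)" if "x \<in> carrier_vec n" for x
    using that P_nonneg[of "F *\<^sub>v x"] scalar_prod_self_nonneg[of "X *\<^sub>v x"]
    by (simp add: MT sq asc)
  have diss: "x \<bullet> (M *\<^sub>v (T *\<^sub>v x - x)) \<le> 0" if x: "x \<in> carrier_vec n" for x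
  proof -
    have "(T * D - D) *\<^sub>v (F *\<^sub>v x) = F *\<^sub>v x - D *\<^sub>v x"
      using x by (simp add: minus_mult_distrib_mat_vec[of _ n n] sq asc Fv DTv DTDv)
    then have "(F *\<^sub>v x) \<bullet> (P *\<^sub>v (F *\<^sub>v x)) - (F *\<^sub>v x) \<bullet> (P *\<^sub>v (D *\<^sub>v x)) \<le> 0"
      using neg[of "F *\<^sub>v x"] x
      by (simp add: mult_minus_distrib_mat_vec[of _ n n] scalar_prod_minus_distrib[of _ n] sq)
    moreover have "x \<bullet> (M *\<^sub>v (T *\<^sub>v x - x)) = x \<bullet> (M *\<^sub>v (T *\<^sub>v x)) - x \<bullet> (M *\<^sub>v x)"
      using x by (simp add: mult_minus_distrib_mat_vec[of _ n n] scalar_prod_minus_distrib[of _ n] sq)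
    ultimately show ?thesis
      using x scalar_prod_self_nonneg[of "V *\<^sub>v x"] comm_scalar_prod[of "X *\<^sub>v x" n "U *\<^sub>v x"]
      unfolding MT[OF x x] form[OF x x] by (simp add: sq)
  qed
  \<comment> \<open>Three test vectors are paired with \<open>M x = 0\<close>: \<open>D x\<close>
    gives \<open>D x = 0\<close> by definiteness of \<open>P\<close>; then \<open>x\<close> itself
    gives \<open>X x = V x = 0\<close>; then arbitrary \<open>z\<close> puts \<open>x\<close> into
    the kernel of the transpose of \<open>X\<close>, where \<open>K\<close> is the identity, so
    \<open>x = V x = 0\<close>.\<close>
  have inj: "x = 0\<^sub>v n" if x: "x \<in> carrier_vec n" and Mx: "M *\<^sub>v x = 0\<^sub>v n" for x
  proof -
    have Mz: "z \<bullet> (M *\<^sub>v x) = 0" if "z \<in> carrier_vec n" for z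
      using that Mx by simp
    have UD: "U *\<^sub>v (D *\<^sub>v x) = 0\<^sub>v n" using x by (simp add: Uv sq DTDv)
    then have "X *\<^sub>v (D *\<^sub>v x) = 0\<^sub>v n" "V *\<^sub>v (D *\<^sub>v x) = 0\<^sub>v n"
      using x by (simp_all add: X_def V_def asc sq mult_mat_zero_vec[of _ n n])
    then have "(D *\<^sub>v x) \<bullet> (P *\<^sub>v (D *\<^sub>v x)) = 0"
      using Mz[of "D *\<^sub>v x"] x form[of "D *\<^sub>v x" x] UD
      by (simp add: sq Fv DTDv scalar_prod_left_zero[of _ n])
    then have D0: "D *\<^sub>v x = 0\<^sub>v n" using pos[of "D *\<^sub>v x"] x by (force simp: sq)
    then have F0: "F *\<^sub>v x = 0\<^sub>v n" and Ux: "U *\<^sub>v x = x"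
      using x by (simp_all add: Fv Uv mult_mat_zero_vec[of _ n n])
    have "(X *\<^sub>v x) \<bullet> (X *\<^sub>v x) + (V *\<^sub>v x) \<bullet> (V *\<^sub>v x) = 0"
      using Mz[OF x] form[OF x x] F0 Ux x comm_scalar_prod[of "X *\<^sub>v x" n x]
      by (simp add: sq scalar_prod_left_zero[of _ n])
    then have X0: "X *\<^sub>v x = 0\<^sub>v n" and V0: "V *\<^sub>v x = 0\<^sub>v n"
      using scalar_prod_self_nonneg[of "X *\<^sub>v x"] scalar_prod_self_nonneg[of "V *\<^sub>v x"]
        scalar_prod_self_eq_0[of "X *\<^sub>v x" n] scalar_prod_self_eq_0[of "V *\<^sub>v x" n] x
      by (auto simp: sq)
    have "X\<^sup>T *\<^sub>v x = 0\<^sub>v n"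
    proof (rule eq_0_of_scalar_prods)
      fix z :: "real vec" assume z: "z \<in> carrier_vec n"
      have "(X *\<^sub>v z) \<bullet> x = 0"
        using Mz[OF z] form[OF z x] x z D0 X0 V0 Ux
        by (simp add: sq mult_mat_zero_vec[of _ n n] scalar_prod_right_zero[of _ n])
      then show "z \<bullet> (X\<^sup>T *\<^sub>v x) = 0" using transpose_scalar_prod[OF X z x] by simp
    qed (use x in \<open>simp add: sq\<close>)
    then have "K *\<^sub>v x = x" using Kfix x by blast
    then show ?thesis using V0 Ux x by (simp add: V_def asc sq)
  qed
  show thesis using that[OF M sym psd diss inj] .
qed

section \<open>Dissipative pencils\<close>

lemma smult_mat_mult_vec:
  fixes A :: "'a :: comm_ring_1 mat"
  assumes "A \<in> carrier_mat m n" "v \<in> carrier_vec n"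
  shows "(k \<cdot>\<^sub>m A) *\<^sub>v v = k \<cdot>\<^sub>v (A *\<^sub>v v)"
  using assms by (intro eq_vecI) (auto simp: scalar_prod_def sum_distrib_left mult.assoc)

text \<open>For invertible \<open>Q\<close> the factor \<open>J - R\<close> has to be
  \<open>A\<close> times the inverse of \<open>Q\<close>, and \<open>J\<close>, \<open>R\<close> are
  its skew part and its negated symmetric part. \<open>M A\<close> is congruent to this factor, so
  dissipativity of the one is semidefiniteness of \<open>R\<close> for the other.\<close>

lemma nondegenerate_dH_iff_multiplier:
  assumes E [simp]: "E \<in> carrier_mat n n" and A [simp]: "A \<in> carrier_mat n n"
  shows "nondegenerate_dH n E A \<longleftrightarrow> (\<exists>M N. M \<in> carrier_mat n n \<and> N \<in> carrier_mat n n \<and>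
    M * N = 1\<^sub>m n \<and> N * M = 1\<^sub>m n \<and> sym_psd n (M * E) \<and>
    (\<forall>x \<in> carrier_vec n. x \<bullet> ((M * A) *\<^sub>v x) \<le> 0))" (is "_ \<longleftrightarrow> ?R")
proof
  note sq = mult_carrier_mat[of _ n n _ n] mult_mat_vec_carrier[of _ n n]
    minus_carrier_vec[of _ n] minus_carrier_mat
  note asc = assoc_mult_mat_vec[of _ n n _ n]
  assume "nondegenerate_dH n E A"
  then obtain J R Q where rep: "dH_representation n E A J R Q" and "invertible_mat Q"
    unfolding nondegenerate_dH_def by blast
  then have J [simp]: "J \<in> carrier_mat n n" and R [simp]: "R \<in> carrier_mat n n"
    and Q [simp]: "Q \<in> carrier_mat n n" and AJ: "A = (J - R) * Q" and skew: "J = - J\<^sup>T"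
    and psdR: "sym_psd n R" and psdE: "sym_psd n (Q\<^sup>T * E)"
    unfolding dH_representation_def by auto
  from \<open>invertible_mat Q\<close> obtain N where QN: "Q * N = 1\<^sub>m n" and NQ: "N * Q = 1\<^sub>m (dim_row N)"
    unfolding invertible_mat_def inverts_mat_def using Q by auto
  \<comment> \<open>\<open>invertible_mat\<close> does not state the size of the inverse; it is read
    off from the two products.\<close>
  have N [simp]: "N \<in> carrier_mat n n"
    using arg_cong[OF QN, of dim_col] arg_cong[OF NQ, of dim_col] carrier_matD[OF Q] by auto
  have "x \<bullet> ((Q\<^sup>T * A) *\<^sub>v x) \<le> 0" if x: "x \<in> carrier_vec n" for x
  proof -
    define y where "y = Q *\<^sub>v x"
    have y [simp]: "y \<in> carrier_vec n" using x by (simp add: y_def sq)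
    have "y \<bullet> (J *\<^sub>v y) = - (y \<bullet> (J\<^sup>T *\<^sub>v y))"
      by (subst skew) (simp add: uminus_mult_mat_vec sq carrier_vecD carrier_matD[OF J])
    moreover have "y \<bullet> (J\<^sup>T *\<^sub>v y) = y \<bullet> (J *\<^sub>v y)"
      using transpose_scalar_prod[OF J y y] comm_scalar_prod[of y n "J *\<^sub>v y"] by (simp add: sq)
    ultimately have "y \<bullet> (J *\<^sub>v y) = 0" by simp
    moreover have "0 \<le> y \<bullet> (R *\<^sub>v y)" using psdR by (simp add: sym_psd_def)
    moreover have "x \<bullet> ((Q\<^sup>T * A) *\<^sub>v x) = y \<bullet> (J *\<^sub>v y) - y \<bullet> (R *\<^sub>v y)"
      using x transpose_scalar_prod[OF Q x, of "A *\<^sub>v x"]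
      by (simp add: asc sq AJ y_def[symmetric] minus_mult_distrib_mat_vec[of _ n n]
        scalar_prod_minus_distrib[of _ n])
    ultimately show ?thesis by simp
  qed
  moreover have "Q\<^sup>T * N\<^sup>T = 1\<^sub>m n"
    using transpose_mult[OF N Q] NQ carrier_matD[OF N] by simp
  moreover have "N\<^sup>T * Q\<^sup>T = 1\<^sub>m n"
    using transpose_mult[OF Q N] QN by simp
  ultimately show ?R using psdE
    by (intro exI[of _ "Q\<^sup>T"] exI[of _ "N\<^sup>T"]) simp
next
  note sq = mult_carrier_mat[of _ n n _ n] mult_mat_vec_carrier[of _ n n]
    minus_carrier_vec[of _ n] minus_carrier_mat
  note asc = assoc_mult_mat_vec[of _ n n _ n]
  assume ?R
  then obtain M N where M [simp]: "M \<in> carrier_mat n n" and N [simp]: "N \<in> carrier_mat n n"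
    and MN: "M * N = 1\<^sub>m n" and NM: "N * M = 1\<^sub>m n" and psd: "sym_psd n (M * E)"
    and diss: "\<And>x. x \<in> carrier_vec n \<Longrightarrow> x \<bullet> ((M * A) *\<^sub>v x) \<le> 0"
    by blast
  define Q where "Q = M\<^sup>T"
  define L where "L = A * N\<^sup>T"
  define J where "J = (1/2) \<cdot>\<^sub>m (L - L\<^sup>T)"
  define R where "R = (- 1/2) \<cdot>\<^sub>m (L + L\<^sup>T)"
  have [simp]: "Q \<in> carrier_mat n n" by (simp add: Q_def)
  have L [simp]: "L \<in> carrier_mat n n" by (simp add: L_def sq)
  have Ld: "dim_row L = n" "dim_col L = n" using carrier_matD[OF L] by auto
  have J [simp]: "J \<in> carrier_mat n n" by (simp add: J_def sq)
  have R [simp]: "R \<in> carrier_mat n n" by (simp add: R_def)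
  have NQ: "N\<^sup>T * Q = 1\<^sub>m n"
    unfolding Q_def using transpose_mult[OF M N] MN by simp
  have QN: "Q * N\<^sup>T = 1\<^sub>m n"
    unfolding Q_def using transpose_mult[OF N M] NM by simp
  have "J - R = L" by (rule eq_matI) (auto simp: J_def R_def Ld field_simps)
  then have AJ: "A = (J - R) * Q"
    by (simp add: L_def assoc_mult_mat[of _ n n _ n _ n] NQ right_mult_one_mat[OF A])
  have skew: "J = - J\<^sup>T" by (rule eq_matI) (auto simp: J_def Ld diff_divide_distrib)
  have RT: "R\<^sup>T = R" by (rule eq_matI) (auto simp: R_def Ld)
  have psdR: "0 \<le> y \<bullet> (R *\<^sub>v y)" if y: "y \<in> carrier_vec n" for y
  proof -
    define x where "x = N\<^sup>T *\<^sub>v y"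
    have x [simp]: "x \<in> carrier_vec n" using y by (simp add: x_def sq)
    have Qx: "Q *\<^sub>v x = y" using y QN assoc_mult_mat_vec[of Q n n "N\<^sup>T" n y] by (simp add: x_def)
    have "y \<bullet> (L *\<^sub>v y) = (M\<^sup>T *\<^sub>v x) \<bullet> (A *\<^sub>v x)"
      using y Qx by (simp add: L_def asc x_def[symmetric] Q_def[symmetric])
    also have "\<dots> = x \<bullet> ((M * A) *\<^sub>v x)"
      using transpose_scalar_prod[of "M\<^sup>T" n n x "A *\<^sub>v x"] by (simp add: asc sq)
    finally have Ly: "y \<bullet> (L *\<^sub>v y) \<le> 0" using diss[OF x] by simp
    have "y \<bullet> (L\<^sup>T *\<^sub>v y) = y \<bullet> (L *\<^sub>v y)"
      using transpose_scalar_prod[OF L y y] comm_scalar_prod[of y n "L *\<^sub>v y"] y by (simp add: sq)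
    moreover have "R *\<^sub>v y = (- 1/2) \<cdot>\<^sub>v (L *\<^sub>v y + L\<^sup>T *\<^sub>v y)"
      using y by (simp add: R_def smult_mat_mult_vec[of _ n n] add_mult_distrib_mat_vec[of _ n n])
    ultimately have "y \<bullet> (R *\<^sub>v y) = - (y \<bullet> (L *\<^sub>v y))"
      using y by (simp add: sq scalar_prod_add_distrib[of _ n] carrier_vecD)
    then show ?thesis using Ly by simp
  qed
  have QE: "Q\<^sup>T * E = M * E" by (simp add: Q_def)
  have "(M * E)\<^sup>T = E\<^sup>T * Q" by (simp add: Q_def transpose_mult[OF M E])
  then have "Q\<^sup>T * E = E\<^sup>T * Q" using psd QE by (simp add: sym_psd_def)
  moreover have "sym_psd n R" using psdR RT by (simp add: sym_psd_def)
  ultimately have "dH_representation n E A J R Q"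
    unfolding dH_representation_def using AJ skew psd QE by simp
  moreover have "invertible_mat Q"
    unfolding invertible_mat_def inverts_mat_def using NQ QN carrier_matD[of Q n n] carrier_matD[OF N]
    by (auto intro!: exI[of _ "N\<^sup>T"])
  ultimately show "nondegenerate_dH n E A" unfolding nondegenerate_dH_def by blast
qed

text \<open>Moving from \<open>x\<close> in the direction \<open>- G x\<close> would make the form
  negative to first order unless \<open>G x = 0\<close>.\<close>

lemma sym_psd_kernel:
  assumes G: "sym_psd n G" and x: "x \<in> carrier_vec n" and x0: "x \<bullet> (G *\<^sub>v x) = 0"
  shows "G *\<^sub>v x = 0\<^sub>v n"
proof -
  have [simp]: "G \<in> carrier_mat n n" and GT: "G\<^sup>T = G"
    using G by (simp_all add: sym_psd_def)
  note sq = mult_mat_vec_carrier[of _ n n]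
  define y where "y = G *\<^sub>v x"
  have y [simp]: "y \<in> carrier_vec n" using x by (simp add: y_def sq)
  define s c where "s = y \<bullet> y" and "c = y \<bullet> (G *\<^sub>v y)"
  have c: "0 \<le> c" using G by (simp add: c_def sym_psd_def)
  have xGy: "x \<bullet> (G *\<^sub>v y) = s"
    using transpose_scalar_prod[of G n n x y] x y GT by (simp add: s_def y_def[symmetric])
  \<comment> \<open>A step short enough for the linear term to dominate; the \<open>+ 1\<close>
    keeps the denominator positive when \<open>c = 0\<close>.\<close>
  define t where "t = s / (c + 1)"
  have ts: "s = t * (c + 1)" using c by (simp add: t_def)
  have "0 \<le> (x - t \<cdot>\<^sub>v y) \<bullet> (G *\<^sub>v (x - t \<cdot>\<^sub>v y))"
    using G x by (simp add: sym_psd_def minus_carrier_vec[of _ n])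
  also have "\<dots> = t\<^sup>2 * c - 2 * t * s"
    using x x0 by (simp add: mult_minus_distrib_mat_vec[of _ n n] mult_mat_vec[of G n n] sq
      scalar_prod_minus_distrib[of _ n] minus_scalar_prod_distrib[of _ n] minus_carrier_vec[of _ n] xGy
      smult_scalar_prod_distrib[of _ n] scalar_prod_smult_distrib[of _ n] y_def[symmetric] s_def[symmetric] c_def[symmetric] power2_eq_square algebra_simps carrier_vecD)
  also have "\<dots> = - (t\<^sup>2 * (c + 2))"
    unfolding ts by (simp add: algebra_simps power2_eq_square)
  finally have "t\<^sup>2 * (c + 2) \<le> 0" by simp
  moreover have "0 < t\<^sup>2 * (c + 2)" if "t \<noteq> 0" using c that by simp
  ultimately have "s = 0" using ts by force
  then show ?thesis using scalar_prod_self_eq_0[OF y] by (simp add: s_def y_def)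
qed

text \<open>The mixed terms between real and imaginary parts are purely imaginary. No symmetry
  enters, so this serves the dissipative matrix as well as the semidefinite one.\<close>

lemma Re_cmat_form:
  assumes G: "G \<in> carrier_mat n n" and x: "x \<in> carrier_vec n"
  shows "Re ((cmat G *\<^sub>v x) \<bullet>c x) =
    map_vec Re x \<bullet> (G *\<^sub>v map_vec Re x) + map_vec Im x \<bullet> (G *\<^sub>v map_vec Im x)"
  unfolding Re_cmat_mult_vec[OF G x, symmetric] Im_cmat_mult_vec[OF G x, symmetric]
  using assms by (simp add: scalar_prod_def Re_sum sum.distrib algebra_simps)

lemma cmat_psd_nonneg:
  assumes "sym_psd n G" "x \<in> carrier_vec n"
  shows "0 \<le> Re ((cmat G *\<^sub>v x) \<bullet>c x)"
  using assms by (auto simp: Re_cmat_form sym_psd_def)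

lemma cmat_psd_kernel:
  assumes G: "sym_psd n G" and x: "x \<in> carrier_vec n" and x0: "Re ((cmat G *\<^sub>v x) \<bullet>c x) = 0"
  shows "cmat G *\<^sub>v x = 0\<^sub>v n"
proof -
  have Gc: "G \<in> carrier_mat n n" using G by (simp add: sym_psd_def)
  have "0 \<le> u \<bullet> (G *\<^sub>v u)" if "u \<in> carrier_vec n" for u using G that by (simp add: sym_psd_def)
  from this[of "map_vec Re x"] this[of "map_vec Im x"]
  have "map_vec Re x \<bullet> (G *\<^sub>v map_vec Re x) = 0" "map_vec Im x \<bullet> (G *\<^sub>v map_vec Im x) = 0"
    using x0 x unfolding Re_cmat_form[OF Gc x] by auto
  then have "map_vec Re (cmat G *\<^sub>v x) = 0\<^sub>v n" "map_vec Im (cmat G *\<^sub>v x) = 0\<^sub>v n"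
    using sym_psd_kernel[OF G] x by (simp_all add: Re_cmat_mult_vec[OF Gc] Im_cmat_mult_vec[OF Gc])
  moreover have "map_vec Re (0\<^sub>v n) = 0\<^sub>v n" "map_vec Im (0\<^sub>v n) = 0\<^sub>v n" by auto
  ultimately show ?thesis by (intro complex_vec_eqI) simp_all
qed

lemma cmat_adjoint:
  assumes G: "G \<in> carrier_mat n n" and x: "x \<in> carrier_vec n" and y: "y \<in> carrier_vec n"
  shows "(cmat G *\<^sub>v x) \<bullet>c y = x \<bullet>c (cmat G\<^sup>T *\<^sub>v y)"
proof -
  have "conjugate (cmat G\<^sup>T *\<^sub>v y) = cmat G\<^sup>T *\<^sub>v conjugate y"
    using G y by (intro eq_vecI) (auto simp: scalar_prod_def intro!: sum.cong)
  moreover have "(cmat G *\<^sub>v x) \<bullet> conjugate y = x \<bullet> (cmat G\<^sup>T *\<^sub>v conjugate y)"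
    using transpose_vec_mult_scalar[of "cmat G\<^sup>T" n n "conjugate y" x] G x y
    by (simp add: map_mat_transpose)
  ultimately show ?thesis by simp
qed

text \<open>To be read with \<open>H = M E\<close> and \<open>K = M A\<close>. The last assumption
  is the form in which regularity of the pencil enters.\<close>

locale dissipative_pencil =
  fixes n :: nat and H K :: "real mat"
  assumes H: "sym_psd n H" and K [simp]: "K \<in> carrier_mat n n"
    and diss: "\<And>x. x \<in> carrier_vec n \<Longrightarrow> x \<bullet> (K *\<^sub>v x) \<le> 0"
    and no_common_kernel:
      "\<And>x. x \<in> carrier_vec n \<Longrightarrow> cmat H *\<^sub>v x = 0\<^sub>v n \<Longrightarrow> cmat K *\<^sub>v x = 0\<^sub>v n \<Longrightarrow> x = 0\<^sub>v n"
begin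

lemma Hc [simp]: "H \<in> carrier_mat n n" using H by (simp add: sym_psd_def)

lemma herm:
  assumes "x \<in> carrier_vec n" "y \<in> carrier_vec n"
  shows "(cmat H *\<^sub>v x) \<bullet>c y = x \<bullet>c (cmat H *\<^sub>v y)"
  using cmat_adjoint[OF Hc assms] H by (simp add: sym_psd_def)

lemma form_real:
  assumes x: "x \<in> carrier_vec n"
  shows "Im ((cmat H *\<^sub>v x) \<bullet>c x) = 0"
proof -
  have Hx: "cmat H *\<^sub>v x \<in> carrier_vec n" using x by (simp add: mult_mat_vec_carrier[of _ n n])
  have "(cmat H *\<^sub>v x) \<bullet>c x = conjugate ((cmat H *\<^sub>v x) \<bullet>c x)"
    using herm[OF x x] conjugate_conjugate_sprod[OF x Hx] conjugate_vec_sprod_comm[OF x Hx]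
      comm_scalar_prod[of "conjugate x" n "cmat H *\<^sub>v x"] x Hx by simp
  then show ?thesis by (simp add: complex_eq_iff)
qed

text \<open>Dissipativity makes \<open>- (K + K\<^sup>T)\<close> semidefinite, so a vector on which
  its form vanishes lies in its kernel. On such vectors \<open>K\<close> can be moved across the
  inner product at the cost of a sign.\<close>

lemma skew_on_neutral:
  assumes x: "x \<in> carrier_vec n" and 0: "Re ((cmat K *\<^sub>v x) \<bullet>c x) = 0"
  shows "cmat K\<^sup>T *\<^sub>v x = - (cmat K *\<^sub>v x)"
proof -
  define G where "G = - (K + K\<^sup>T)"
  have Kd: "dim_row K = n" "dim_col K = n" using carrier_matD[OF K] by auto
  have G [simp]: "G \<in> carrier_mat n n" by (simp add: G_def)
  have GT: "G\<^sup>T = G" by (rule eq_matI) (auto simp: G_def Kd)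
  have Gy: "y \<bullet> (G *\<^sub>v y) = - 2 * (y \<bullet> (K *\<^sub>v y))" if y: "y \<in> carrier_vec n" for y
  proof -
    have "y \<bullet> (K\<^sup>T *\<^sub>v y) = y \<bullet> (K *\<^sub>v y)"
      using transpose_scalar_prod[OF K y y] comm_scalar_prod[of y n "K *\<^sub>v y"] y
      by (simp add: mult_mat_vec_carrier[of _ n n])
    then show ?thesis using y
      by (simp add: G_def uminus_mult_mat_vec Kd add_mult_distrib_mat_vec[of _ n n] carrier_vecD
        scalar_prod_add_distrib[of _ n] mult_mat_vec_carrier[of _ n n])
  qed
  have psd: "sym_psd n G" unfolding sym_psd_def using GT Gy diss by simp
  have "Re ((cmat G *\<^sub>v x) \<bullet>c x) = 0"
    using 0 x unfolding Re_cmat_form[OF G x] Re_cmat_form[OF K x] by (simp add: Gy)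
  from cmat_psd_kernel[OF psd x this]
  have "cmat G *\<^sub>v x = 0\<^sub>v n" .
  moreover have "cmat G = - (cmat K + cmat K\<^sup>T)" by (rule eq_matI) (auto simp: G_def Kd)
  ultimately have "- (cmat K *\<^sub>v x + cmat K\<^sup>T *\<^sub>v x) = 0\<^sub>v n"
    using x by (simp add: uminus_mult_mat_vec Kd add_mult_distrib_mat_vec[of _ n n] carrier_vecD)
  then have *: "(- (cmat K *\<^sub>v x + cmat K\<^sup>T *\<^sub>v x)) $ i = 0" if "i < n" for i using that by simp
  show ?thesis
    by (rule eq_vecI) (use * in \<open>auto simp: Kd add_eq_0_iff\<close>)
qed

text \<open>Pairing with \<open>x\<close> gives \<open>Re z\<close> times the nonnegative form of
  \<open>H\<close> on the left and a nonpositive number on the right. For \<open>Re z > 0\<close>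
  the form of \<open>H\<close> vanishes, and \<open>x\<close> becomes a common kernel
  vector.\<close>

lemma eigenvalue_Re_nonpos:
  assumes x: "x \<in> carrier_vec n" "x \<noteq> 0\<^sub>v n" and ev: "cmat K *\<^sub>v x = z \<cdot>\<^sub>v (cmat H *\<^sub>v x)"
  shows "Re z \<le> 0"
proof (rule ccontr)
  let ?h = "(cmat H *\<^sub>v x) \<bullet>c x"
  assume "\<not> Re z \<le> 0"
  have h: "0 \<le> Re ?h" by (rule cmat_psd_nonneg[OF H x(1)])
  have "(cmat K *\<^sub>v x) \<bullet>c x = z * ?h"
    unfolding ev using x Hc by (simp add: carrier_vecD carrier_matD[OF Hc])
  then have "Re ((cmat K *\<^sub>v x) \<bullet>c x) = Re z * Re ?h" using form_real[OF x(1)] by simp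
  moreover have "Re ((cmat K *\<^sub>v x) \<bullet>c x) \<le> 0"
    unfolding Re_cmat_form[OF K x(1)] using diss[of "map_vec Re x"] diss[of "map_vec Im x"] x by simp
  ultimately have "Re ?h = 0"
    using h \<open>\<not> Re z \<le> 0\<close> by (metis antisym_conv2 linorder_not_le mult_pos_pos)
  then have "cmat H *\<^sub>v x = 0\<^sub>v n" by (rule cmat_psd_kernel[OF H x(1)])
  moreover have "cmat K *\<^sub>v x = 0\<^sub>v n" unfolding ev calculation by auto
  ultimately show False using no_common_kernel x by blast
qed

text \<open>The product of \<open>K x1\<close> with \<open>x0\<close> is computed twice. The chain
  equation gives \<open>z b + a\<close>; moving \<open>K\<close> onto the neutral vector
  \<open>x0\<close> gives \<open>z b\<close>, since \<open>cnj z = - z\<close>. Hence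
  \<open>a\<close>, the form of \<open>H\<close> at \<open>x0\<close>, vanishes.\<close>

lemma imaginary_chain_trivial:
  assumes z: "Re z = 0" and x0: "x0 \<in> carrier_vec n" and x1: "x1 \<in> carrier_vec n"
    and 0: "cmat K *\<^sub>v x0 = z \<cdot>\<^sub>v (cmat H *\<^sub>v x0)"
    and 1: "cmat K *\<^sub>v x1 = z \<cdot>\<^sub>v (cmat H *\<^sub>v x1) + cmat H *\<^sub>v x0"
  shows "x0 = 0\<^sub>v n"
proof -
  note c = mult_mat_vec_carrier[of _ n n]
  define a b where "a = (cmat H *\<^sub>v x0) \<bullet>c x0" and "b = x1 \<bullet>c (cmat H *\<^sub>v x0)"
  have Hx: "cmat H *\<^sub>v x0 \<in> carrier_vec n" "cmat H *\<^sub>v x1 \<in> carrier_vec n"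
    using x0 x1 by (simp_all add: c)
  have cnjz: "cnj z = - z" using z by (simp add: complex_eq_iff)
  have "(cmat K *\<^sub>v x0) \<bullet>c x0 = z * a"
    unfolding 0 a_def using x0 Hx by (simp add: carrier_vecD)
  then have "Re ((cmat K *\<^sub>v x0) \<bullet>c x0) = 0" using z form_real[OF x0] by (simp add: a_def)
  then have skew: "cmat K\<^sup>T *\<^sub>v x0 = - (cmat K *\<^sub>v x0)" by (rule skew_on_neutral[OF x0])
  have "(cmat K *\<^sub>v x1) \<bullet>c x0 = z * b + a"
    unfolding 1 using x0 x1 Hx herm[OF x1 x0]
    by (simp add: add_scalar_prod_distrib[of _ n] a_def b_def carrier_vecD)
  moreover have "(cmat K *\<^sub>v x1) \<bullet>c x0 = z * b"
    unfolding cmat_adjoint[OF K x1 x0] skew 0 using x1 Hx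
    by (simp add: conjugate_smult_vec cnjz b_def carrier_vecD carrier_matD[OF Hc]
      uminus_conjugate_vec[symmetric])
  ultimately have "a = 0" by simp
  then have "cmat H *\<^sub>v x0 = 0\<^sub>v n" using cmat_psd_kernel[OF H x0] by (simp add: a_def)
  moreover have "cmat K *\<^sub>v x0 = 0\<^sub>v n" unfolding 0 calculation by auto
  ultimately show ?thesis using no_common_kernel x0 by blast
qed

text \<open>Again \<open>K x1\<close> is paired with \<open>x0\<close>: it is 0 because
  \<open>K x1 = H x2\<close> and \<open>H x0 = 0\<close>, and it is minus the form of
  \<open>H\<close> at \<open>x1\<close> because \<open>x0\<close> is neutral and
  \<open>K x0 = H x1\<close>. So \<open>H x1 = 0\<close>, hence \<open>K x0 = 0\<close>.\<close>

lemma infinite_chain_trivial: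
  assumes x: "x0 \<in> carrier_vec n" "x1 \<in> carrier_vec n" "x2 \<in> carrier_vec n"
    and 0: "cmat H *\<^sub>v x0 = 0\<^sub>v n" and 1: "cmat H *\<^sub>v x1 = cmat K *\<^sub>v x0"
    and 2: "cmat H *\<^sub>v x2 = cmat K *\<^sub>v x1"
  shows "x0 = 0\<^sub>v n"
proof -
  note c = mult_mat_vec_carrier[of _ n n]
  have "(cmat K *\<^sub>v x0) \<bullet>c x0 = 0"
    unfolding 1[symmetric] herm[OF x(2,1)] 0 using x by simp
  then have skew: "cmat K\<^sup>T *\<^sub>v x0 = - (cmat K *\<^sub>v x0)" by (intro skew_on_neutral[OF x(1)]) simp
  have "(cmat K *\<^sub>v x1) \<bullet>c x0 = - (x1 \<bullet>c (cmat H *\<^sub>v x1))"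
    unfolding cmat_adjoint[OF K x(2,1)] skew 1[symmetric] using x
    by (simp add: c uminus_conjugate_vec[symmetric] carrier_vecD carrier_matD[OF Hc])
  moreover have "(cmat K *\<^sub>v x1) \<bullet>c x0 = 0"
    unfolding 2[symmetric] herm[OF x(3,1)] 0 using x by simp
  ultimately have "(cmat H *\<^sub>v x1) \<bullet>c x1 = 0" using herm[OF x(2,2)] by simp
  then have "cmat H *\<^sub>v x1 = 0\<^sub>v n" using cmat_psd_kernel[OF H x(2)] by simp
  then show ?thesis using no_common_kernel[OF x(1) 0] 1 by simp
qed

end

section \<open>Stable pencils\<close>

lemma cancel_smult_vec:
  fixes v w :: "complex vec"
  assumes "l \<noteq> 0" "l \<cdot>\<^sub>v v = l \<cdot>\<^sub>v w"
  shows "v = w"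
proof (rule eq_vecI)
  show dim: "dim_vec v = dim_vec w" using arg_cong[OF assms(2), of dim_vec] by simp
  fix i assume "i < dim_vec w"
  then show "v $ i = w $ i" using arg_cong[OF assms(2), of "\<lambda>u. u $ i"] dim assms(1) by simp
qed

text \<open>The hypotheses express (i) to (iv) through vectors instead of chains;
  \<open>imag\<close> admits \<open>z = 0\<close> and thus covers (ii) and (iv) at once.\<close>

lemma multiplier_of_stable_pencil:
  assumes E [simp]: "E \<in> carrier_mat n n" and A [simp]: "A \<in> carrier_mat n n"
    and spec: "\<And>z x. x \<in> carrier_vec n \<Longrightarrow> x \<noteq> 0\<^sub>v n \<Longrightarrow>
      cmat A *\<^sub>v x = z \<cdot>\<^sub>v (cmat E *\<^sub>v x) \<Longrightarrow> Re z \<le> 0"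
    and imag: "\<And>z x0 x1. Re z = 0 \<Longrightarrow> x0 \<in> carrier_vec n \<Longrightarrow> x1 \<in> carrier_vec n \<Longrightarrow>
      cmat A *\<^sub>v x0 = z \<cdot>\<^sub>v (cmat E *\<^sub>v x0) \<Longrightarrow>
      cmat A *\<^sub>v x1 = z \<cdot>\<^sub>v (cmat E *\<^sub>v x1) + cmat E *\<^sub>v x0 \<Longrightarrow> x0 = 0\<^sub>v n"
    and inf: "\<And>x0 x1 x2. x0 \<in> carrier_vec n \<Longrightarrow> x1 \<in> carrier_vec n \<Longrightarrow> x2 \<in> carrier_vec n \<Longrightarrow>
      cmat E *\<^sub>v x0 = 0\<^sub>v n \<Longrightarrow> cmat E *\<^sub>v x1 = cmat A *\<^sub>v x0 \<Longrightarrow> cmat E *\<^sub>v x2 = cmat A *\<^sub>v x1 \<Longrightarrow>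
      x0 = 0\<^sub>v n"
  obtains M N where "M \<in> carrier_mat n n" "N \<in> carrier_mat n n" "M * N = 1\<^sub>m n" "N * M = 1\<^sub>m n"
    "sym_psd n (M * E)" "\<And>x. x \<in> carrier_vec n \<Longrightarrow> x \<bullet> ((M * A) *\<^sub>v x) \<le> 0"
proof -
  note sq = mult_carrier_mat[of _ n n _ n] mult_mat_vec_carrier[of _ n n]
    minus_carrier_vec[of _ n] minus_carrier_mat
  note asc = assoc_mult_mat_vec[of _ n n _ n]
  define G where "G = E - A"
  have G [simp]: "G \<in> carrier_mat n n" by (simp add: G_def sq)
  have "v = 0\<^sub>v n" if v: "v \<in> carrier_vec n" and Gv: "G *\<^sub>v v = 0\<^sub>v n" for v
  proof (rule ccontr)
    assume "v \<noteq> 0\<^sub>v n"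
    have "E *\<^sub>v v - A *\<^sub>v v = 0\<^sub>v n"
      using Gv v by (simp add: G_def minus_mult_distrib_mat_vec[of _ n n])
    then have *: "(E *\<^sub>v v - A *\<^sub>v v) $ i = 0" if "i < n" for i using that by simp
    have "A *\<^sub>v v = E *\<^sub>v v"
      by (rule eq_vecI)
        (use * carrier_matD[OF E] carrier_matD[OF A] in \<open>auto simp del: index_mult_mat_vec\<close>)
    then have "cmat A *\<^sub>v cvec v = 1 \<cdot>\<^sub>v (cmat E *\<^sub>v cvec v)"
      using v cmat_mult_vec[OF A v] cmat_mult_vec[OF E v] by simp
    then show False using spec[of "cvec v" 1] v \<open>v \<noteq> 0\<^sub>v n\<close> by simp
  qed
  then obtain F where F [simp]: "F \<in> carrier_mat n n" and GF: "G * F = 1\<^sub>m n" and FG: "F * G = 1\<^sub>m n"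
    using inverse_of_trivial_kernel[OF G] by blast
  define T where "T = F * E"
  have T [simp]: "T \<in> carrier_mat n n" by (simp add: T_def sq)
  have GT: "G * T = E"
    using assoc_mult_mat[OF G F E] GF left_mult_one_mat[OF E] by (simp add: T_def)
  have AEG: "A = E - G" by (rule eq_matI) (use carrier_matD[OF E] carrier_matD[OF A] in \<open>auto simp: G_def\<close>)
  have FE: "F *\<^sub>v (E *\<^sub>v x) = T *\<^sub>v x" if "x \<in> carrier_vec n" for x
    using that by (simp add: T_def asc)
  have FA: "F *\<^sub>v (A *\<^sub>v x) = T *\<^sub>v x - x" if x: "x \<in> carrier_vec n" for x
  proof -
    have "F *\<^sub>v (G *\<^sub>v x) = x" using x assoc_mult_mat_vec[OF F G x] FG by simp
    then show ?thesis
      unfolding AEG using x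
      by (simp add: minus_mult_distrib_mat_vec[of _ n n] mult_minus_distrib_mat_vec[of _ n n] sq FE)
  qed
  have cE: "cmat E *\<^sub>v y = cmat G *\<^sub>v (cmat T *\<^sub>v y)" if "y \<in> carrier_vec n" for y
    using that cmat_mult[OF G T] GT assoc_mult_mat_vec[of "cmat G" n n "cmat T" n y] by simp
  have cA: "cmat A *\<^sub>v y = cmat G *\<^sub>v (cmat T *\<^sub>v y - y)" if y: "y \<in> carrier_vec n" for y
  proof -
    have "cmat A = cmat E - cmat G"
      by (rule eq_matI) (use carrier_matD[OF E] carrier_matD[OF A] in \<open>auto simp: G_def\<close>)
    then show ?thesis
      using y by (simp add: minus_mult_distrib_mat_vec[of _ n n] mult_minus_distrib_mat_vec[of _ n n] sq cE)
  qed
  have "T *\<^sub>v (T *\<^sub>v v) = 0\<^sub>v n" if v: "v \<in> carrier_vec n" "T *\<^sub>v (T *\<^sub>v (T *\<^sub>v v)) = 0\<^sub>v n" for v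
  proof -
    define p where "p = T *\<^sub>v v"
    define q where "q = T *\<^sub>v p"
    have p: "p \<in> carrier_vec n" and q: "q \<in> carrier_vec n" using v by (simp_all add: p_def q_def sq)
    have Tq: "T *\<^sub>v q = 0\<^sub>v n" using v by (simp add: p_def q_def)
    define Tc where "Tc = cmat T"
    have Tc [simp]: "Tc \<in> carrier_mat n n" by (simp add: Tc_def)
    have cT: "Tc *\<^sub>v cvec v = cvec p" "Tc *\<^sub>v cvec p = cvec q" "Tc *\<^sub>v cvec q = 0\<^sub>v n"
      unfolding Tc_def cmat_mult_vec[OF T v(1), symmetric] cmat_mult_vec[OF T p, symmetric]
        cmat_mult_vec[OF T q, symmetric] p_def[symmetric] q_def[symmetric] Tq
      by auto
    have carr: "cvec v \<in> carrier_vec n" "cvec p \<in> carrier_vec n" "cvec q \<in> carrier_vec n"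
      using v p q by auto
    \<comment> \<open>The middle vector of a chain at infinity from \<open>q\<close> to
      \<open>v\<close>. It must satisfy \<open>T x1 = (T - 1) q = - q\<close>, so
      \<open>x1 = - p + a q\<close> is a solution for any scalar \<open>a\<close>; the next equation
      \<open>T v = (T - 1) x1 = p - (1 + a) q\<close> forces \<open>a = -1\<close> when
      \<open>q\<close> is nonzero.\<close>
    have T1: "Tc *\<^sub>v (- cvec p - cvec q) = - cvec q"
    proof -
      have "- cvec p - cvec q = (-1) \<cdot>\<^sub>v cvec p - cvec q" using carr by (intro eq_vecI) auto
      then have "Tc *\<^sub>v (- cvec p - cvec q) = (-1) \<cdot>\<^sub>v cvec q - 0\<^sub>v n"
        using carr cT by (simp add: mult_minus_distrib_mat_vec[of _ n n] mult_mat_vec[of _ n n])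
      also have "\<dots> = - cvec q" using carr by (intro eq_vecI) auto
      finally show ?thesis .
    qed
    have "cvec q = 0\<^sub>v n"
    proof (rule inf[of _ "- cvec p - cvec q" "cvec v"])
      show "cmat E *\<^sub>v cvec q = 0\<^sub>v n"
        using carr cT by (simp add: cE Tc_def mult_mat_zero_vec[of _ n n])
      have "Tc *\<^sub>v cvec q - cvec q = - cvec q"
        using cT carr by (intro eq_vecI) auto
      then show "cmat E *\<^sub>v (- cvec p - cvec q) = cmat A *\<^sub>v cvec q"
        using carr T1 by (simp add: cE cA Tc_def sq)
      have "Tc *\<^sub>v (- cvec p - cvec q) - (- cvec p - cvec q) = cvec p"
        unfolding T1 using carr by (intro eq_vecI) auto
      then show "cmat E *\<^sub>v cvec v = cmat A *\<^sub>v (- cvec p - cvec q)"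
        using carr cT by (simp add: cE cA Tc_def sq)
    qed (use carr in \<open>simp_all add: sq\<close>)
    then show ?thesis by (simp add: q_def p_def)
  qed
  then obtain D where D [simp]: "D \<in> carrier_mat n n" and DT: "D * T = T * D"
    and DTD: "D * (T * D) = D" and TTTD: "T * (T * (T * D)) = T * T"
    using drazin_inverse_index_two[OF T] by blast
  define B where "B = T * D - D"
  have B [simp]: "B \<in> carrier_mat n n" by (simp add: B_def sq)
  define Tc Dc where "Tc = cmat T" and "Dc = cmat D"
  have Tc [simp]: "Tc \<in> carrier_mat n n" and Dc [simp]: "Dc \<in> carrier_mat n n"
    by (simp_all add: Tc_def Dc_def)
  have DTv: "Dc *\<^sub>v (Tc *\<^sub>v x) = Tc *\<^sub>v (Dc *\<^sub>v x)" if "x \<in> carrier_vec n" for x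
    using that arg_cong[OF DT, of "\<lambda>X. cmat X *\<^sub>v x"]
    by (simp add: asc sq cmat_mult[of _ n n _ n] Tc_def Dc_def)
  have TDD: "Tc *\<^sub>v (Dc *\<^sub>v (Dc *\<^sub>v x)) = Dc *\<^sub>v x" if "x \<in> carrier_vec n" for x
    using that arg_cong[OF DTD, of "\<lambda>X. cmat X *\<^sub>v x"]
    by (simp add: asc sq cmat_mult[of _ n n _ n] Tc_def[symmetric] Dc_def[symmetric] DTv)
  have Bv: "cmat B *\<^sub>v x = Tc *\<^sub>v (Dc *\<^sub>v x) - Dc *\<^sub>v x" if "x \<in> carrier_vec n" for x
  proof -
    have "cmat B = cmat (T * D) - cmat D"
      by (rule eq_matI) (use carrier_matD[OF T] carrier_matD[OF D] in \<open>auto simp: B_def\<close>)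
    then show ?thesis
      using that by (simp add: cmat_mult[of _ n n _ n] minus_mult_distrib_mat_vec[of _ n n] asc sq Tc_def Dc_def)
  qed
  have BB: "Tc *\<^sub>v (Dc *\<^sub>v (cmat B *\<^sub>v x)) = cmat B *\<^sub>v x" if "x \<in> carrier_vec n" for x
    using that by (simp add: Bv mult_minus_distrib_mat_vec[of _ n n] sq DTv TDD)
  \<comment> \<open>\<open>B\<close> maps into the range of \<open>T D\<close>, hence so do its
    eigenvectors for nonzero eigenvalues belong there.\<close>
  have fixed: "Tc *\<^sub>v (Dc *\<^sub>v w) = w"
    if w: "w \<in> carrier_vec n" and Bw: "cmat B *\<^sub>v w = l \<cdot>\<^sub>v w" and l: "l \<noteq> 0" for w l
  proof (rule cancel_smult_vec[OF l])
    show "l \<cdot>\<^sub>v (Tc *\<^sub>v (Dc *\<^sub>v w)) = l \<cdot>\<^sub>v w"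
      using BB[OF w] w unfolding Bw by (simp add: mult_mat_vec[of _ n n] sq)
  qed
  \<comment> \<open>On the range of \<open>T D\<close>, \<open>B u\<close> is
    \<open>u - D u\<close>. Applying \<open>T\<close> gives \<open>T u - u = l T u + T r\<close>,
    and applying \<open>G\<close> turns this into the pencil relation: Jordan chains of
    \<open>B\<close> there are chains of the pencil at the same eigenvalue.\<close>
  have key: "cmat A *\<^sub>v u = l \<cdot>\<^sub>v (cmat E *\<^sub>v u) + cmat E *\<^sub>v r"
    if u: "u \<in> carrier_vec n" and r: "r \<in> carrier_vec n" and fix_u: "Tc *\<^sub>v (Dc *\<^sub>v u) = u"
      and Bu: "cmat B *\<^sub>v u = l \<cdot>\<^sub>v u + r" for u r l
  proof -
    have "Tc *\<^sub>v (u - Dc *\<^sub>v u) = Tc *\<^sub>v (l \<cdot>\<^sub>v u + r)"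
      using Bu Bv[OF u] fix_u by simp
    then have "Tc *\<^sub>v u - u = l \<cdot>\<^sub>v (Tc *\<^sub>v u) + Tc *\<^sub>v r"
      using u r fix_u
      by (simp add: mult_minus_distrib_mat_vec[of _ n n] mult_add_distrib_mat_vec[of _ n n]
        mult_mat_vec[of _ n n] sq)
    then show ?thesis
      using u r by (simp add: cA cE Tc_def[symmetric] sq mult_add_distrib_mat_vec[of _ n n]
        mult_mat_vec[of _ n n])
  qed
  have specB: "Re l \<le> 0"
    if v: "v \<in> carrier_vec n" "v \<noteq> 0\<^sub>v n" and ev: "cmat B *\<^sub>v v = l \<cdot>\<^sub>v v" for l v
  proof (cases "l = 0")
    case False
    have "cmat A *\<^sub>v v = l \<cdot>\<^sub>v (cmat E *\<^sub>v v) + cmat E *\<^sub>v 0\<^sub>v n"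
      using key[OF v(1) _ fixed[OF v(1) ev False], of "0\<^sub>v n" l] v ev by simp
    then show ?thesis using spec[OF v] v(1) by (simp add: mult_mat_zero_vec[of _ n n] sq)
  qed simp
  have ndB: "nondefective_at n (cmat B) l" if l: "Re l = 0" for l
    unfolding nondefective_at_def
  proof (intro ballI impI; elim conjE)
    fix v w
    assume v: "v \<in> carrier_vec n" and w: "w \<in> carrier_vec n"
      and 1: "cmat B *\<^sub>v v = l \<cdot>\<^sub>v v + w" and 2: "cmat B *\<^sub>v w = l \<cdot>\<^sub>v w"
    have fix_w: "Tc *\<^sub>v (Dc *\<^sub>v w) = w"
    proof (cases "l = 0")
      case True
      have "l \<cdot>\<^sub>v v + w = w" using True v w by (intro eq_vecI) auto
      then show ?thesis using BB[OF v] 1 by simp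
    qed (rule fixed[OF w 2])
    \<comment> \<open>\<open>w\<close> lies in the range of \<open>T D\<close>, but \<open>v\<close>
      need not. Its projection has the same image under \<open>B\<close> and still satisfies the
      chain equation.\<close>
    define v' where "v' = Tc *\<^sub>v (Dc *\<^sub>v v)"
    have v': "v' \<in> carrier_vec n" using v by (simp add: v'_def sq)
    have fix_v': "Tc *\<^sub>v (Dc *\<^sub>v v') = v'" using v by (simp add: v'_def sq DTv TDD)
    have "cmat B *\<^sub>v v' = cmat B *\<^sub>v v" using v by (simp add: Bv v'_def sq DTv TDD)
    also have "\<dots> = Tc *\<^sub>v (Dc *\<^sub>v (l \<cdot>\<^sub>v v + w))" using BB[OF v] 1 by simp
    also have "\<dots> = l \<cdot>\<^sub>v v' + w"
      using v w by (simp add: mult_add_distrib_mat_vec[of _ n n] mult_mat_vec[of _ n n] sq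
        v'_def fix_w)
    finally have v'_ev: "cmat B *\<^sub>v v' = l \<cdot>\<^sub>v v' + w" .
    have "cmat A *\<^sub>v w = l \<cdot>\<^sub>v (cmat E *\<^sub>v w) + cmat E *\<^sub>v 0\<^sub>v n"
      by (rule key[OF w _ fix_w]) (use 2 w in simp_all)
    then have "cmat A *\<^sub>v w = l \<cdot>\<^sub>v (cmat E *\<^sub>v w)"
      using w by (simp add: mult_mat_zero_vec[of _ n n] sq)
    then show "w = 0\<^sub>v n"
      using imag[OF l w v'] key[OF v' w fix_v' v'_ev] by blast
  qed
  obtain P where P: "P \<in> carrier_mat n n" "P\<^sup>T = P"
    "\<And>x. x \<in> carrier_vec n \<Longrightarrow> x \<noteq> 0\<^sub>v n \<Longrightarrow> 0 < x \<bullet> (P *\<^sub>v x)"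
    "\<And>x. x \<in> carrier_vec n \<Longrightarrow> x \<bullet> (P *\<^sub>v (B *\<^sub>v x)) \<le> 0"
    by (rule lyapunov[OF B specB ndB]; (rule that)?; assumption)
  obtain M0 where M0 [simp]: "M0 \<in> carrier_mat n n" and M0T: "(M0 * T)\<^sup>T = M0 * T"
    and psd: "\<And>x. x \<in> carrier_vec n \<Longrightarrow> 0 \<le> x \<bullet> ((M0 * T) *\<^sub>v x)"
    and diss: "\<And>x. x \<in> carrier_vec n \<Longrightarrow> x \<bullet> (M0 *\<^sub>v (T *\<^sub>v x - x)) \<le> 0"
    and inj: "\<And>x. x \<in> carrier_vec n \<Longrightarrow> M0 *\<^sub>v x = 0\<^sub>v n \<Longrightarrow> x = 0\<^sub>v n"
    using dissipative_multiplier[OF T D P(1) DT DTD TTTD P(2,3)] P(4) unfolding B_def by blast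
  obtain N0 where N0 [simp]: "N0 \<in> carrier_mat n n" and MN: "M0 * N0 = 1\<^sub>m n" and NM: "N0 * M0 = 1\<^sub>m n"
    using inverse_of_trivial_kernel[OF M0] inj by blast
  note asm = assoc_mult_mat[of _ n n _ n _ n]
  have cancel: "F * (G * Y) = Y" "N0 * (M0 * Y) = Y" if "Y \<in> carrier_mat n n" for Y
    using that assoc_mult_mat[OF F G that] assoc_mult_mat[OF N0 M0 that] FG NM
    by (simp_all add: left_mult_one_mat[of _ n n])
  show thesis
  \<comment> \<open>\<open>F\<close> is the inverse of \<open>G\<close>, so \<open>F E = T\<close>
    and \<open>F A = T - 1\<close> reduce the claims to those for \<open>M0\<close>.\<close>
  proof (rule that[of "M0 * F" "G * N0"])
    show "(M0 * F) * (G * N0) = 1\<^sub>m n" by (simp add: asm sq cancel MN)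
    show "(G * N0) * (M0 * F) = 1\<^sub>m n" by (simp add: asm sq cancel GF)
    have "(M0 * F) * E = M0 * T" by (simp add: asm T_def)
    then show "sym_psd n ((M0 * F) * E)" using M0T psd by (simp add: sym_psd_def sq)
    show "x \<bullet> (((M0 * F) * A) *\<^sub>v x) \<le> 0" if "x \<in> carrier_vec n" for x
      using diss[OF that] that by (simp add: asc sq asm FA)
  qed (simp_all add: sq)
qed

section \<open>Chains\<close>

lemma pencil_eigenvalue_iff:
  assumes "E \<in> carrier_mat n n" "A \<in> carrier_mat n n"
  shows "pencil_eigenvalue n E A z \<longleftrightarrow>
    (\<exists>x \<in> carrier_vec n. x \<noteq> 0\<^sub>v n \<and> cmat A *\<^sub>v x = z \<cdot>\<^sub>v (cmat E *\<^sub>v x))"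
proof -
  have "pencil E A z *\<^sub>v x = 0\<^sub>v n \<longleftrightarrow> cmat A *\<^sub>v x = z \<cdot>\<^sub>v (cmat E *\<^sub>v x)"
    if "x \<in> carrier_vec n" for x
  proof -
    define a e where "a = cmat A *\<^sub>v x" and "e = z \<cdot>\<^sub>v (cmat E *\<^sub>v x)"
    have ae: "a \<in> carrier_vec n" "e \<in> carrier_vec n"
      using assms that by (simp_all add: a_def e_def mult_mat_vec_carrier[of _ n n])
    have "pencil E A z *\<^sub>v x = e - a"
      using assms that by (simp add: a_def e_def pencil_def minus_mult_distrib_mat_vec[of _ n n]
        smult_mat_mult_vec[of _ n n])
    moreover have "a = e" if "e - a = 0\<^sub>v n"
    proof (rule eq_vecI)
      fix i assume "i < dim_vec e"
      then show "a $ i = e $ i" using arg_cong[OF that, of "\<lambda>v. v $ i"] ae by simp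
    qed (use ae in simp)
    ultimately show ?thesis using ae unfolding a_def[symmetric] e_def[symmetric] by auto
  qed
  then show ?thesis unfolding pencil_eigenvalue_def by blast
qed

lemma shifted_mult_eq_iff:
  assumes "E \<in> carrier_mat n n" "A \<in> carrier_mat n n" "x \<in> carrier_vec n" "y \<in> carrier_vec n"
  shows "(cmat A - z \<cdot>\<^sub>m cmat E) *\<^sub>v x = y \<longleftrightarrow> cmat A *\<^sub>v x = z \<cdot>\<^sub>v (cmat E *\<^sub>v x) + y"
proof -
  define a e where "a = cmat A *\<^sub>v x" and "e = z \<cdot>\<^sub>v (cmat E *\<^sub>v x)"
  have ae: "a \<in> carrier_vec n" "e \<in> carrier_vec n"
    using assms by (simp_all add: a_def e_def mult_mat_vec_carrier[of _ n n])
  have "(cmat A - z \<cdot>\<^sub>m cmat E) *\<^sub>v x = a - e"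
    using assms
    by (simp add: a_def e_def minus_mult_distrib_mat_vec[of _ n n] smult_mat_mult_vec[of _ n n])
  moreover have "a - e = y \<longleftrightarrow> a = e + y"
  proof
    show "a = e + y" if "a - e = y" unfolding that[symmetric] using ae by (intro eq_vecI) auto
    show "a - e = y" if "a = e + y" unfolding that using ae assms(4) by (intro eq_vecI) auto
  qed
  ultimately show ?thesis by (simp add: a_def e_def)
qed

locale regular_pair =
  fixes n :: nat and E A :: "real mat"
  assumes E [simp]: "E \<in> carrier_mat n n" and A [simp]: "A \<in> carrier_mat n n"
    and regular: "regular_pencil E A"
begin

lemma no_common_kernel:
  assumes x: "x \<in> carrier_vec n" and Ex: "cmat E *\<^sub>v x = 0\<^sub>v n" and Ax: "cmat A *\<^sub>v x = 0\<^sub>v n"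
  shows "x = 0\<^sub>v n"
proof -
  obtain m where "invertible_mat (pencil E A m)" using regular by (auto simp: regular_pencil_def)
  then obtain W where WP: "W * pencil E A m = 1\<^sub>m (dim_row W)"
    and PW: "pencil E A m * W = 1\<^sub>m (dim_row (pencil E A m))"
    unfolding invertible_mat_def inverts_mat_def by blast
  have P: "pencil E A m \<in> carrier_mat n n" by (simp add: pencil_def minus_carrier_mat)
  have "dim_row W = n" "dim_col W = n"
    using arg_cong[OF WP, of dim_col] arg_cong[OF PW, of dim_col] P by auto
  then have W: "W * pencil E A m = 1\<^sub>m n" "W \<in> carrier_mat n n" using WP by auto
  have "m \<cdot>\<^sub>v 0\<^sub>v n = (0\<^sub>v n :: complex vec)" by auto
  then have "pencil E A m *\<^sub>v x = 0\<^sub>v n"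
    using x Ex Ax
    by (simp add: pencil_def minus_mult_distrib_mat_vec[of _ n n] smult_mat_mult_vec[of _ n n])
  then show ?thesis
    using assoc_mult_mat_vec[OF W(2) P x] W x by (simp add: mult_mat_zero_vec[of _ n n])
qed

text \<open>A longer chain restricts to its first two vectors. Conversely \<open>x1\<close> is
  nonzero on its own: \<open>x1 = 0\<close> would put \<open>x0\<close> into both kernels.\<close>

lemma semisimple_at_iff:
  "semisimple_at n E A z \<longleftrightarrow> (\<forall>x0 \<in> carrier_vec n. \<forall>x1 \<in> carrier_vec n.
     cmat A *\<^sub>v x0 = z \<cdot>\<^sub>v (cmat E *\<^sub>v x0) \<and>
     cmat A *\<^sub>v x1 = z \<cdot>\<^sub>v (cmat E *\<^sub>v x1) + cmat E *\<^sub>v x0 \<longrightarrow> x0 = 0\<^sub>v n)" (is "_ \<longleftrightarrow> ?R")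
proof
  have first: "(cmat A - z \<cdot>\<^sub>m cmat E) *\<^sub>v x = 0\<^sub>v n \<longleftrightarrow> cmat A *\<^sub>v x = z \<cdot>\<^sub>v (cmat E *\<^sub>v x)"
    if "x \<in> carrier_vec n" for x
    using shifted_mult_eq_iff[OF E A that, of "0\<^sub>v n"] that
    by (simp add: right_zero_vec[of _ n] mult_mat_vec_carrier[of _ n n])
  note step = shifted_mult_eq_iff[OF E A]
  assume ss: "semisimple_at n E A z"
  show ?R
  proof (intro ballI impI; elim conjE)
    fix x0 x1
    assume x: "x0 \<in> carrier_vec n" "x1 \<in> carrier_vec n"
      and 0: "cmat A *\<^sub>v x0 = z \<cdot>\<^sub>v (cmat E *\<^sub>v x0)"
      and 1: "cmat A *\<^sub>v x1 = z \<cdot>\<^sub>v (cmat E *\<^sub>v x1) + cmat E *\<^sub>v x0"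
    have Ex0: "cmat E *\<^sub>v x0 \<in> carrier_vec n" using x by (simp add: mult_mat_vec_carrier[of _ n n])
    show "x0 = 0\<^sub>v n"
    proof (rule ccontr)
      assume nz: "x0 \<noteq> 0\<^sub>v n"
      have "x1 \<noteq> 0\<^sub>v n"
      proof
        assume "x1 = 0\<^sub>v n"
        moreover have "z \<cdot>\<^sub>v 0\<^sub>v n = (0\<^sub>v n :: complex vec)" by auto
        ultimately have "cmat E *\<^sub>v x0 = 0\<^sub>v n"
          using 1 Ex0 by (simp add: mult_mat_zero_vec[of _ n n])
        moreover from this have "cmat A *\<^sub>v x0 = 0\<^sub>v n" using 0 by auto
        ultimately show False using no_common_kernel x nz by blast
      qed
      then have "finite_chain n E A z [x0, x1]"
        using x nz first[OF x(1)] 0 step[OF x(2) Ex0] 1 by (simp add: finite_chain_def)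
      then show False using ss unfolding semisimple_at_def by force
    qed
  qed
next
  have first: "(cmat A - z \<cdot>\<^sub>m cmat E) *\<^sub>v x = 0\<^sub>v n \<longleftrightarrow> cmat A *\<^sub>v x = z \<cdot>\<^sub>v (cmat E *\<^sub>v x)"
    if "x \<in> carrier_vec n" for x
    using shifted_mult_eq_iff[OF E A that, of "0\<^sub>v n"] that
    by (simp add: right_zero_vec[of _ n] mult_mat_vec_carrier[of _ n n])
  note step = shifted_mult_eq_iff[OF E A]
  assume R: ?R
  show "semisimple_at n E A z"
    unfolding semisimple_at_def
  proof
    assume "\<exists>xs. finite_chain n E A z xs \<and> length xs > 1"
    then obtain xs where ch: "finite_chain n E A z xs" and len: "Suc 0 < length xs" by auto
    then have "xs ! 0 \<in> set xs" "xs ! Suc 0 \<in> set xs" by (auto intro!: nth_mem)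
    then have x: "xs ! 0 \<in> carrier_vec n" "xs ! Suc 0 \<in> carrier_vec n" and nz: "xs ! 0 \<noteq> 0\<^sub>v n"
      using ch unfolding finite_chain_def by blast+
    have Ex0: "cmat E *\<^sub>v (xs ! 0) \<in> carrier_vec n" using x by (simp add: mult_mat_vec_carrier[of _ n n])
    have "(cmat A - z \<cdot>\<^sub>m cmat E) *\<^sub>v (xs ! 0) = 0\<^sub>v n"
      "(cmat A - z \<cdot>\<^sub>m cmat E) *\<^sub>v (xs ! Suc 0) = cmat E *\<^sub>v (xs ! 0)"
      using ch len unfolding finite_chain_def by blast+
    then show False using R x nz first[OF x(1)] step[OF x(2) Ex0] by blast
  qed
qed

text \<open>Longer chains restrict to their first three vectors. That \<open>x1\<close> and
  \<open>x2\<close> are nonzero remains a premise: a missing common kernel alone does not exclude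
  \<open>x2 = 0\<close>, and the theorem below uses (iv) for that.\<close>

lemma pencil_index_le_two_iff:
  "pencil_index n E A \<le> 2 \<longleftrightarrow>
    (\<forall>x0 \<in> carrier_vec n. \<forall>x1 \<in> carrier_vec n. \<forall>x2 \<in> carrier_vec n.
      x1 \<noteq> 0\<^sub>v n \<and> x2 \<noteq> 0\<^sub>v n \<and>
      cmat E *\<^sub>v x0 = 0\<^sub>v n \<and> cmat E *\<^sub>v x1 = cmat A *\<^sub>v x0 \<and> cmat E *\<^sub>v x2 = cmat A *\<^sub>v x1 \<longrightarrow>
      x0 = 0\<^sub>v n)" (is "_ \<longleftrightarrow> ?R")
proof -
  have "pencil_index n E A \<le> 2 \<longleftrightarrow> (\<forall>xs. infinite_chain n E A xs \<longrightarrow> length xs \<le> 2)"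
    by (simp add: pencil_index_def SUP_le_iff numeral_eq_enat)
  also have "\<dots> \<longleftrightarrow> ?R"
  proof
    assume L: "\<forall>xs. infinite_chain n E A xs \<longrightarrow> length xs \<le> 2"
    show ?R
    proof (intro ballI impI; elim conjE)
      fix x0 x1 x2
      assume x: "x0 \<in> carrier_vec n" "x1 \<in> carrier_vec n" "x2 \<in> carrier_vec n"
        and nz: "x1 \<noteq> 0\<^sub>v n" "x2 \<noteq> 0\<^sub>v n"
        and eqs: "cmat E *\<^sub>v x0 = 0\<^sub>v n" "cmat E *\<^sub>v x1 = cmat A *\<^sub>v x0" "cmat E *\<^sub>v x2 = cmat A *\<^sub>v x1"
      show "x0 = 0\<^sub>v n"
      proof (rule ccontr)
        assume "x0 \<noteq> 0\<^sub>v n"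
        then have "infinite_chain n E A [x0, x1, x2]"
          using x nz eqs by (auto simp: infinite_chain_def less_Suc_eq)
        then show False using L by force
      qed
    qed
  next
    assume R: ?R
    show "\<forall>xs. infinite_chain n E A xs \<longrightarrow> length xs \<le> 2"
    proof (intro allI impI; rule ccontr)
      fix xs assume ch: "infinite_chain n E A xs" and "\<not> length xs \<le> 2"
      then have len: "Suc (Suc 0) < length xs" by auto
      then have "xs ! 0 \<in> set xs" "xs ! Suc 0 \<in> set xs" "xs ! Suc (Suc 0) \<in> set xs"
        by (auto intro!: nth_mem)
      then have "xs ! 0 \<in> carrier_vec n" "xs ! Suc 0 \<in> carrier_vec n" "xs ! Suc (Suc 0) \<in> carrier_vec n"
        and "xs ! 0 \<noteq> 0\<^sub>v n" "xs ! Suc 0 \<noteq> 0\<^sub>v n" "xs ! Suc (Suc 0) \<noteq> 0\<^sub>v n"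
        using ch unfolding infinite_chain_def by blast+
      moreover have "cmat E *\<^sub>v (xs ! 0) = 0\<^sub>v n" "cmat E *\<^sub>v (xs ! Suc 0) = cmat A *\<^sub>v (xs ! 0)"
        "cmat E *\<^sub>v (xs ! Suc (Suc 0)) = cmat A *\<^sub>v (xs ! Suc 0)"
        using ch len unfolding infinite_chain_def by (blast dest: Suc_lessD)+
      ultimately show False using R by blast
    qed
  qed
  finally show ?thesis .
qed

text \<open>A chain of the reversed pencil at infinity is literally a chain of the pencil at 0, so
  (iv) supplies the case \<open>z = 0\<close> that (ii) leaves out.\<close>

lemma reversed_index_le_one_iff: "pencil_index n A E \<le> 1 \<longleftrightarrow> semisimple_at n E A 0"
proof -
  have "cmat A - 0 \<cdot>\<^sub>m cmat E = cmat A"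
    by (rule eq_matI) (use carrier_matD[OF E] carrier_matD[OF A] in auto)
  then have "infinite_chain n A E xs \<longleftrightarrow> finite_chain n E A 0 xs" for xs
    by (simp add: infinite_chain_def finite_chain_def)
  then have "pencil_index n A E \<le> 1 \<longleftrightarrow> (\<forall>xs. finite_chain n E A 0 xs \<longrightarrow> length xs \<le> 1)"
    by (simp add: pencil_index_def SUP_le_iff one_enat_def)
  then show ?thesis unfolding semisimple_at_def by (auto simp: not_less)
qed

end

theorem corollaryB11:
  fixes n :: nat and E A :: "real mat"
  assumes "E \<in> carrier_mat n n" and "A \<in> carrier_mat n n"
    and "regular_pencil E A"
  shows "nondegenerate_dH n E A \<longleftrightarrow>
      (\<forall>z. pencil_eigenvalue n E A z \<longrightarrow> Re z \<le> 0) \<and>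
      (\<forall>z. pencil_eigenvalue n E A z \<and> z \<noteq> 0 \<and> Re z = 0 \<longrightarrow> semisimple_at n E A z) \<and>
      pencil_index n E A \<le> 2 \<and>
      pencil_index n A E \<le> 1"
proof -
  interpret regular_pair n E A by (rule regular_pair.intro[OF assms])
  show ?thesis
  proof
    assume "nondegenerate_dH n E A"
    then obtain M N where M: "M \<in> carrier_mat n n" and N: "N \<in> carrier_mat n n" and NM: "N * M = 1\<^sub>m n"
      and psd: "sym_psd n (M * E)"
      and diss: "\<And>x. x \<in> carrier_vec n \<Longrightarrow> x \<bullet> ((M * A) *\<^sub>v x) \<le> 0"
      unfolding nondegenerate_dH_iff_multiplier[OF E A] by blast
    have cM: "cmat (M * Y) *\<^sub>v x = cmat M *\<^sub>v (cmat Y *\<^sub>v x)"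
      if "Y \<in> carrier_mat n n" "x \<in> carrier_vec n" for Y x
      using that M cmat_mult[OF M that(1)] assoc_mult_mat_vec[of "cmat M" n n "cmat Y" n x] by simp
    have inj: "y = 0\<^sub>v n" if y: "y \<in> carrier_vec n" and My: "cmat M *\<^sub>v y = 0\<^sub>v n" for y
    proof -
      have "cmat N * cmat M = 1\<^sub>m n"
        using cmat_mult[OF N M] NM by (simp add: of_real_hom.mat_hom_one)
      then have "y = cmat N *\<^sub>v (cmat M *\<^sub>v y)"
        using assoc_mult_mat_vec[of "cmat N" n n "cmat M" n y] M N y by simp
      then show ?thesis using My N by (simp add: mult_mat_zero_vec[of _ n n])
    qed
    interpret dissipative_pencil n "M * E" "M * A"
    proof
      fix x
      assume x: "x \<in> carrier_vec n"
        and "cmat (M * E) *\<^sub>v x = 0\<^sub>v n" "cmat (M * A) *\<^sub>v x = 0\<^sub>v n"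
      then show "x = 0\<^sub>v n"
        using no_common_kernel[OF x] inj[of "cmat E *\<^sub>v x"] inj[of "cmat A *\<^sub>v x"]
        by (simp add: cM mult_mat_vec_carrier[of _ n n])
    qed (use psd diss M in \<open>simp_all add: mult_carrier_mat[of _ n n]\<close>)
    \<comment> \<open>Proved on the whole imaginary axis; the instance \<open>z = 0\<close> yields
      (iv).\<close>
    have semisimple: "semisimple_at n E A z" if "Re z = 0" for z
      unfolding semisimple_at_iff
    proof (intro ballI impI; elim conjE)
      fix x0 x1
      assume x: "x0 \<in> carrier_vec n" "x1 \<in> carrier_vec n"
        and eqs: "cmat A *\<^sub>v x0 = z \<cdot>\<^sub>v (cmat E *\<^sub>v x0)"
          "cmat A *\<^sub>v x1 = z \<cdot>\<^sub>v (cmat E *\<^sub>v x1) + cmat E *\<^sub>v x0"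
      show "x0 = 0\<^sub>v n"
        by (rule imaginary_chain_trivial[OF that x])
          (use x eqs M in \<open>simp_all add: cM mult_mat_vec[of _ n n] mult_add_distrib_mat_vec[of _ n n]
            mult_mat_vec_carrier[of _ n n]\<close>)
    qed
    moreover have "pencil_index n E A \<le> 2"
      unfolding pencil_index_le_two_iff
    proof (intro ballI impI; elim conjE)
      fix x0 x1 x2
      assume x: "x0 \<in> carrier_vec n" "x1 \<in> carrier_vec n" "x2 \<in> carrier_vec n"
        and eqs: "cmat E *\<^sub>v x0 = 0\<^sub>v n" "cmat E *\<^sub>v x1 = cmat A *\<^sub>v x0" "cmat E *\<^sub>v x2 = cmat A *\<^sub>v x1"
      show "x0 = 0\<^sub>v n"
        by (rule infinite_chain_trivial[OF x])
          (use M in \<open>simp_all add: cM x eqs mult_mat_zero_vec[of _ n n]\<close>)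
    qed
    moreover have "Re z \<le> 0" if ev: "pencil_eigenvalue n E A z" for z
    proof -
      obtain x where x: "x \<in> carrier_vec n" "x \<noteq> 0\<^sub>v n"
        and eq: "cmat A *\<^sub>v x = z \<cdot>\<^sub>v (cmat E *\<^sub>v x)"
        using ev unfolding pencil_eigenvalue_iff[OF E A] by blast
      show ?thesis
        by (rule eigenvalue_Re_nonpos[OF x])
          (use M x in \<open>simp add: cM eq mult_mat_vec[of _ n n] mult_mat_vec_carrier[of _ n n]\<close>)
    qed
    ultimately show "(\<forall>z. pencil_eigenvalue n E A z \<longrightarrow> Re z \<le> 0) \<and>
      (\<forall>z. pencil_eigenvalue n E A z \<and> z \<noteq> 0 \<and> Re z = 0 \<longrightarrow> semisimple_at n E A z) \<and>
      pencil_index n E A \<le> 2 \<and> pencil_index n A E \<le> 1"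
      by (simp add: reversed_index_le_one_iff)
  next
    assume R: "(\<forall>z. pencil_eigenvalue n E A z \<longrightarrow> Re z \<le> 0) \<and>
      (\<forall>z. pencil_eigenvalue n E A z \<and> z \<noteq> 0 \<and> Re z = 0 \<longrightarrow> semisimple_at n E A z) \<and>
      pencil_index n E A \<le> 2 \<and> pencil_index n A E \<le> 1"
    have spec: "Re z \<le> 0"
      if "x \<in> carrier_vec n" "x \<noteq> 0\<^sub>v n" "cmat A *\<^sub>v x = z \<cdot>\<^sub>v (cmat E *\<^sub>v x)" for z x
      using that R unfolding pencil_eigenvalue_iff[OF E A] by blast
    have imag: "x0 = 0\<^sub>v n"
      if "Re z = 0" and x: "x0 \<in> carrier_vec n" "x1 \<in> carrier_vec n"
        and 0: "cmat A *\<^sub>v x0 = z \<cdot>\<^sub>v (cmat E *\<^sub>v x0)"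
        and 1: "cmat A *\<^sub>v x1 = z \<cdot>\<^sub>v (cmat E *\<^sub>v x1) + cmat E *\<^sub>v x0" for z x0 x1
    proof (rule ccontr)
      assume nz: "x0 \<noteq> 0\<^sub>v n"
      then have "pencil_eigenvalue n E A z" using pencil_eigenvalue_iff[OF E A] x 0 by blast
      then have "semisimple_at n E A z"
        using R \<open>Re z = 0\<close> by (cases "z = 0") (simp_all add: reversed_index_le_one_iff)
      then show False using semisimple_at_iff x 0 1 nz by blast
    qed
    have inf: "x0 = 0\<^sub>v n"
      if x: "x0 \<in> carrier_vec n" "x1 \<in> carrier_vec n" "x2 \<in> carrier_vec n"
        and eqs: "cmat E *\<^sub>v x0 = 0\<^sub>v n" "cmat E *\<^sub>v x1 = cmat A *\<^sub>v x0" "cmat E *\<^sub>v x2 = cmat A *\<^sub>v x1"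
      for x0 x1 x2
    proof (rule ccontr)
      assume nz: "x0 \<noteq> 0\<^sub>v n"
      have Ex: "cmat E *\<^sub>v y \<in> carrier_vec n" if "y \<in> carrier_vec n" for y
        using that by (simp add: mult_mat_vec_carrier[of _ n n])
      have z0: "0 \<cdot>\<^sub>v (cmat E *\<^sub>v y) = 0\<^sub>v n" if "y \<in> carrier_vec n" for y
        using Ex[OF that] carrier_matD[OF E] by (intro eq_vecI) simp_all
      have x1: "x1 \<noteq> 0\<^sub>v n"
      proof
        assume "x1 = 0\<^sub>v n"
        then have "cmat A *\<^sub>v x0 = 0\<^sub>v n" using eqs(2) by (simp add: mult_mat_zero_vec[of _ n n])
        then show False using no_common_kernel[OF x(1) eqs(1)] nz by simp
      qed
      \<comment> \<open>If \<open>x2 = 0\<close>, then \<open>(x1, x0)\<close> satisfies the chain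
        equations at eigenvalue 0, and \<open>imag\<close> at \<open>z = 0\<close> forces
        \<open>x1 = 0\<close>.\<close>
      have "x2 \<noteq> 0\<^sub>v n"
      proof
        assume "x2 = 0\<^sub>v n"
        then have "cmat A *\<^sub>v x1 = 0\<^sub>v n" using eqs(3) by (simp add: mult_mat_zero_vec[of _ n n])
        then have "cmat A *\<^sub>v x1 = 0 \<cdot>\<^sub>v (cmat E *\<^sub>v x1)" using z0[OF x(2)] by simp
        moreover have "cmat A *\<^sub>v x0 = 0 \<cdot>\<^sub>v (cmat E *\<^sub>v x0) + cmat E *\<^sub>v x1"
          unfolding z0[OF x(1)] left_zero_vec[OF Ex[OF x(2)]] by (rule eqs(2)[symmetric])
        ultimately have "x1 = 0\<^sub>v n" by (intro imag[OF _ x(2,1)]) simp_all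
        then show False using x1 by simp
      qed
      then show False using R x eqs x1 nz unfolding pencil_index_le_two_iff by blast
    qed
    obtain M N where "M \<in> carrier_mat n n" "N \<in> carrier_mat n n" "M * N = 1\<^sub>m n" "N * M = 1\<^sub>m n"
      "sym_psd n (M * E)" "\<And>x. x \<in> carrier_vec n \<Longrightarrow> x \<bullet> ((M * A) *\<^sub>v x) \<le> 0"
      by (rule multiplier_of_stable_pencil[OF E A spec imag inf]; (rule that)?; assumption)
    then show "nondegenerate_dH n E A"
      unfolding nondegenerate_dH_iff_multiplier[OF E A] by blast
  qed
qed

end
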